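(* Let $a(\omega,p)$ be a locally bounded function on $S^{d-1}\times\{p\in\mathbf{R}:p<0\}$ that is homogeneous of non-integral degree $-\beta<0$ in $p$, i.e. $a(\omega,\lambda p)=\lambda^{-\beta}a(\omega,p)$ for all $\lambda>0$, $p<0$. Then there exists at most one non-negative measure $\mu\in M_{\mathrm{loc}}(\mathbf{R}^d\setminus\{0\})$ with finite mass on sets bounded away from the origin such that $\mu(H_{\omega,p})=a(\omega,p)$ for almost all halfspaces $H_{\omega,p}$ with $\overline{H_{\omega,p}}\subset\mathbf{R}^d\setminus\{0\}$. Such a measure $\mu$, if it exists, is homogeneous of degree $-d-\beta$ and satisfies $R\mu=\partial_pa$ in $S^{d-1}\times\{p\in\mathbf{R}:p<0\}$.
   Context: $H_{\omega,p}=\{x\in\mathbf{R}^d:x\cdot\omega<p\}$; its closure avoids $0$ iff $p<0$; "almost all" is with respect to surface measure on $S^{d-1}$ times Lebesgue measure. $M_{\mathrm{loc}}(\Omega)$ denotes signed Radon measures on $\Omega$. A measure $\mu$ on $\mathbf{R}^d\setminus\{0\}$ is homogeneous of degree $\alpha$ if $\int\varphi(x/\lambda)\,d\mu(x)=\lambda^{d+\alpha}\int\varphi\,d\mu$ for all smooth $\varphi$ compactly supported in $\mathbf{R}^d\setminus\{0\}$ and all $\lambda>0$. $R\mu$ on $S^{d-1}\times(-\infty,0)$: $\langle R\mu,\psi\rangle=\int R^*\psi\,d\mu$ for $\psi$ continuous with compact support in $S^{d-1}\times(-\infty,0)$, $R^*\psi(x)=\int_{S^{d-1}}\psi(\omega,x\cdot\omega)\,d\omega$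 (normalized surface measure). $\partial_pa$ is the distributional derivative in $p$: $\langle\partial_pa,\psi\rangle=-\iint a\,\partial_p\psi\,dp\,d\omega$. *)

theory Defs
  imports "HOL-Analysis.Analysis"
begin

definition halfspace :: "'a::euclidean_space \<Rightarrow> real \<Rightarrow> 'a set" where
  "halfspace \<omega> p = {x. x \<bullet> \<omega> < p}"

text \<open>Normalized surface measure on the unit sphere S^{d-1}, realised as the
  cone measure: push-forward of the normalized Lebesgue measure on the unit
  ball under radial projection x / |x|.\<close>
definition sphere_measure :: "'a::euclidean_space measure" where
  "sphere_measure = distr (uniform_measure lborel (ball 0 1))
      (restrict_space borel (sphere 0 1)) (\<lambda>x. x /\<^sub>R norm x)"

definition halfspace_params_measure :: "('a::euclidean_space \<times> real) measure" where
  "halfspace_params_measure = sphere_measure \<Otimes>\<^sub>M restrict_space lborel {..<0}"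

fun Ck_fun :: "nat \<Rightarrow> ('a::euclidean_space \<Rightarrow> real) \<Rightarrow> bool" where
  "Ck_fun 0 f = continuous_on UNIV f"
| "Ck_fun (Suc k) f = ((\<forall>x. f differentiable (at x)) \<and>
      (\<forall>b\<in>Basis. Ck_fun k (\<lambda>x. frechet_derivative f (at x) b)))"

definition smooth_fun :: "('a::euclidean_space \<Rightarrow> real) \<Rightarrow> bool" where
  "smooth_fun f \<longleftrightarrow> (\<forall>k. Ck_fun k f)"

text \<open>Non-negative Borel measure on R^d \ {0} (no mass at the origin)
  with finite mass on sets bounded away from the origin.\<close>
definition admissible_measure :: "'a::euclidean_space measure \<Rightarrow> bool" where
  "admissible_measure M \<longleftrightarrow> sets M = sets borel \<and> emeasure M {0} = 0 \<and>
     (\<forall>r>0. emeasure M {x. r \<le> norm x} < \<infinity>)"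

definition homogeneous_measure :: "'a::euclidean_space measure \<Rightarrow> real \<Rightarrow> bool" where
  "homogeneous_measure M \<alpha> \<longleftrightarrow>
     (\<forall>\<phi> :: 'a \<Rightarrow> real. \<forall>c>0.
        smooth_fun \<phi> \<and> compact (closure {x. \<phi> x \<noteq> 0}) \<and> 0 \<notin> closure {x. \<phi> x \<noteq> 0} \<longrightarrow>
        (\<integral>x. \<phi> (x /\<^sub>R c) \<partial>M) = c powr (real DIM('a) + \<alpha>) * (\<integral>x. \<phi> x \<partial>M))"

definition dual_radon :: "('a::euclidean_space \<times> real \<Rightarrow> real) \<Rightarrow> 'a \<Rightarrow> real" where
  "dual_radon \<psi> x = (\<integral>\<omega>. \<psi> (\<omega>, x \<bullet> \<omega>) \<partial>sphere_measure)"

text \<open>Test functions on S^{d-1} x (-infinity,0): restrictions of smooth functions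
  whose support on S^{d-1} x R is compact and contained in S^{d-1} x (-infinity,0).\<close>
definition halfspace_test_fun :: "('a::euclidean_space \<times> real \<Rightarrow> real) \<Rightarrow> bool" where
  "halfspace_test_fun \<psi> \<longleftrightarrow> smooth_fun \<psi> \<and>
     compact (closure {z \<in> sphere 0 1 \<times> UNIV. \<psi> z \<noteq> 0}) \<and>
     closure {z \<in> sphere 0 1 \<times> UNIV. \<psi> z \<noteq> 0} \<subseteq> sphere 0 1 \<times> {..<0}"

text \<open>R mu = partial_p a in the sense of distributions on S^{d-1} x (-infinity,0).\<close>
definition radon_eq_dp :: "'a::euclidean_space measure \<Rightarrow> ('a \<times> real \<Rightarrow> real) \<Rightarrow> bool" where
  "radon_eq_dp M a \<longleftrightarrow>
     (\<forall>\<psi>. halfspace_test_fun \<psi> \<longrightarrow>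
        (\<integral>x. dual_radon \<psi> x \<partial>M) =
        - (\<integral>z. a z * deriv (\<lambda>q. \<psi> (fst z, q)) (snd z) \<partial>completion halfspace_params_measure))"

end

theory Submission
  imports Defs "HOL-Probability.Probability" "HOL-Real_Asymp.Real_Asymp"
begin

text \<open>
  For almost every direction the hypothesis holds for all \<open>p < 0\<close> by left continuity, and finitely many
  such half-spaces cover the complement of a ball; so non-negativity of the measure and homogeneity of \<open>a\<close> bound the mass of
  \<open>|x| \<ge> r\<close> by \<open>C r powr (- \<beta>)\<close>. With \<open>k = \<lfloor>\<beta>\<rfloor>\<close>, non-integrality of \<open>\<beta>\<close> makes both
  \<open>|x| ^ (k + 1)\<close> near 0 and \<open>|x| ^ k\<close> near infinity integrable, hence so are the ridge functions
  \<open>g (x \<bullet> \<xi>)\<close> where \<open>g\<close> is \<open>exp (\<i> s)\<close> minus its Taylor polynomial of degree \<open>k\<close>. Two solutions integrate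
  them equally, since their projections to a line agree off the origin. Taking differences in \<open>\<xi>\<close>
  of order larger than \<open>k\<close> removes the Taylor polynomials and leaves \<open>exp (\<i> \<xi> \<bullet> x)\<close> times a non-negative
  weight vanishing only at 0: the two weighted measures are finite with equal Fourier transforms, so
  the solutions coincide. Homogeneity follows by applying uniqueness to a rescaled solution, and the
  equation for the Radon transform by Fubini's theorem and integration in \<open>p\<close>.
\<close>

section \<open>Surface measure\<close>

text \<open>The map \<open>x /\<^sub>R norm x\<close> sends 0 to 0, which lies outside the sphere, so it is not measurable into
  the space restricted to the sphere; it has to be redefined at 0 before the theory of \<open>distr\<close> applies.\<close>

lemma sphere_measure_eq_distr:
  fixes e :: "'a::euclidean_space"
  assumes e: "norm e = 1"
  defines "f \<equiv> \<lambda>x::'a. if x = 0 then e else sgn x"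
  shows "sphere_measure = distr (uniform_measure lborel (ball 0 1)) (restrict_space borel (sphere 0 1)) f"
    and "f \<in> measurable (uniform_measure lborel (ball 0 1)) (restrict_space borel (sphere 0 1))"
proof -
  let ?U = "uniform_measure lborel (ball (0::'a) 1)" and ?S = "restrict_space borel (sphere (0::'a) 1)"
  have fb: "f \<in> borel_measurable borel"
    unfolding f_def by measurable
  then show fm: "f \<in> measurable ?U ?S"
    by (auto simp: measurable_restrict_space2_iff f_def norm_sgn e)
  have "emeasure ?U ((\<lambda>x. x /\<^sub>R norm x) -` A \<inter> space ?U) = emeasure ?U (f -` A \<inter> space ?U)"
    if "A \<in> sets ?S" for A
  proof (rule emeasure_eq_AE)
    have A: "A \<in> sets borel" using that by (auto simp: sets_restrict_space)
    have "AE x in lborel. x \<noteq> (0::'a)"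
      by (rule AE_lborel_singleton)
    then have "AE x in ?U. x \<noteq> 0"
      by (intro AE_uniform_measureI) auto
    then show "AE x in ?U. (x \<in> (\<lambda>x. x /\<^sub>R norm x) -` A \<inter> space ?U) = (x \<in> f -` A \<inter> space ?U)"
      by eventually_elim (auto simp: f_def sgn_div_norm)
    show "(\<lambda>x. x /\<^sub>R norm x) -` A \<inter> space ?U \<in> sets ?U"
      using A by (auto intro!: measurable_sets[of _ borel borel, simplified])
    show "f -` A \<inter> space ?U \<in> sets ?U"
      using A fb by (auto intro!: measurable_sets[of _ borel borel, simplified])
  qed
  moreover have "sigma_sets (space ?S) (sets ?S) = sets ?S" by (rule sets.sigma_sets_eq)
  ultimately show "sphere_measure = distr ?U ?S f"
    unfolding sphere_measure_def distr_def
    by (intro measure_of_eq sets.space_closed) blast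
qed

lemma space_sphere_measure: "space (sphere_measure :: 'a::euclidean_space measure) = sphere 0 1"
  by (simp add: sphere_measure_def space_restrict_space)

lemma sets_sphere_measure[measurable_cong]:
  "sets (sphere_measure :: 'a::euclidean_space measure) = sets (restrict_space borel (sphere 0 1))"
  by (simp add: sphere_measure_def)

lemma prob_space_uniform_ball: "prob_space (uniform_measure lborel (ball (0::'a::euclidean_space) 1))"
  using emeasure_lborel_ball_finite[of "0::'a" 1] content_ball_pos[of 1 "0::'a"]
  by (intro prob_space_uniform_measure) (auto simp: measure_def)

lemma prob_space_sphere_measure: "prob_space (sphere_measure :: 'a::euclidean_space measure)"
proof -
  obtain e :: 'a where e: "norm e = 1" using vector_choose_size[of 1] by auto
  show ?thesis
    using prob_space.prob_space_distr[OF prob_space_uniform_ball sphere_measure_eq_distr(2)[OF e]]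
      sphere_measure_eq_distr(1)[OF e] by simp
qed

text \<open>A non-empty open set, shrunk into the unit ball, has positive Lebesgue measure and
  cannot lie inside the exceptional null set; shrinking does not change directions. Since
  \<open>U\<close> is arbitrary, every vector, not only a unit vector, is a limit of vectors whose
  direction satisfies \<open>P\<close>.\<close>

lemma AE_sphere_measure_dense:
  fixes P :: "'a::euclidean_space \<Rightarrow> bool"
  assumes P: "AE \<omega> in sphere_measure. P \<omega>" and U: "open U" "U \<noteq> {}"
  obtains y where "y \<in> U" "y \<noteq> 0" "P (sgn y)"
proof -
  obtain e :: 'a where e: "norm e = 1" using vector_choose_size[of 1] by auto
  let ?f = "\<lambda>x::'a. if x = 0 then e else sgn x"
  have "AE x in uniform_measure lborel (ball (0::'a) 1). P (?f x)"
    using P AE_distrD[OF sphere_measure_eq_distr(2)[OF e]] unfolding sphere_measure_eq_distr(1)[OF e]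
    by blast
  moreover have "emeasure lborel (ball (0::'a) 1) \<noteq> 0"
    using content_ball_pos[of 1 "0::'a"] by (auto simp: measure_def)
  ultimately have ae: "AE x in lborel. x \<in> ball (0::'a) 1 \<longrightarrow> P (?f x)"
    using emeasure_lborel_ball_finite[of "0::'a" 1]
    by (subst (asm) AE_uniform_measure) auto
  obtain u where u: "u \<in> U" using U by auto
  \<comment> \<open>This factor puts \<open>u\<close> strictly inside the unit ball, and it is
    positive also for \<open>u = 0\<close>.\<close>
  define c where "c = 1 / (2 * norm u + 2)"
  have c: "c > 0" by (auto simp: c_def add_nonneg_pos)
  have "c * norm u < 1" by (simp add: c_def divide_simps add_nonneg_pos)
  define V where "V = ((*\<^sub>R) c ` U) \<inter> ball 0 1"
  have "open V" unfolding V_def using U c by (intro open_Int open_scaling) auto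
  moreover have "c *\<^sub>R u \<in> V" using u c \<open>c * norm u < 1\<close> by (auto simp: V_def)
  ultimately have "\<not> negligible V" using open_not_negligible by blast
  \<comment> \<open>\<open>negligible\<close> refers to the completed measure, hence the passage
    from \<open>lborel\<close> to \<open>lebesgue\<close>. Excluding \<open>x = 0\<close> discards
    the auxiliary value \<open>e\<close>.\<close>
  moreover have "AE x in lebesgue. x \<in> ball (0::'a) 1 \<longrightarrow> x \<noteq> 0 \<longrightarrow> P (sgn x)"
    using ae by (intro AE_completion) (auto elim!: eventually_mono)
  then obtain N where N: "N \<in> null_sets lebesgue" "{x. \<not> (x \<in> ball (0::'a) 1 \<longrightarrow> x \<noteq> 0 \<longrightarrow> P (sgn x))} \<subseteq> N"
    by (auto simp: eventually_ae_filter)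
  ultimately have "\<not> V \<subseteq> insert 0 N"
    using negligible_subset[of "insert 0 N"] by (auto simp: negligible_iff_null_sets)
  then obtain x where "x \<in> V" "x \<noteq> 0" "x \<notin> N" by auto
  then have "x \<in> ball 0 1" "P (sgn x)" using N(2) by (auto simp: V_def)
  moreover obtain y where y: "y \<in> U" "x = c *\<^sub>R y" "y \<noteq> 0"
    using \<open>x \<in> V\<close> \<open>x \<noteq> 0\<close> unfolding V_def by auto
  then have "sgn x = sgn y" using c by (simp add: sgn_scaleR)
  ultimately show ?thesis using y that by auto
qed

section \<open>Masses of half-spaces and tails\<close>

lemma halfspace_sets[measurable]: "halfspace \<omega> p \<in> sets borel"
  unfolding halfspace_def by measurable

lemma halfspace_subset: 
  assumes "norm \<omega> = 1" "p \<le> 0" shows "halfspace \<omega> p \<subseteq> {x. -p \<le> norm x}"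
proof
  fix x assume "x \<in> halfspace \<omega> p"
  moreover have "\<bar>x \<bullet> \<omega>\<bar> \<le> norm x" using Cauchy_Schwarz_ineq2[of x \<omega>] assms by simp
  ultimately show "x \<in> {x. -p \<le> norm x}" by (auto simp: halfspace_def)
qed

lemma admissible_measure_sets: "admissible_measure M \<Longrightarrow> sets M = sets borel"
  by (simp add: admissible_measure_def)

lemma admissible_finite:
  assumes "admissible_measure M" "r > 0" "A \<subseteq> {x. r \<le> norm x}"
  shows "emeasure M A < \<infinity>"
proof -
  have "emeasure M A \<le> emeasure M {x. r \<le> norm x}"
    using assms by (intro emeasure_mono) (auto simp: admissible_measure_sets)
  then show ?thesis using assms unfolding admissible_measure_def using le_less_trans by blast
qed

lemma admissible_halfspace_finite:
  assumes "admissible_measure M" "norm \<omega> = 1" "p < 0"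
  shows "emeasure M (halfspace \<omega> p) < \<infinity>"
  using admissible_finite[OF assms(1), of "-p"] halfspace_subset[of \<omega> p] assms by auto

text \<open>Fubini gives the identity for almost every \<open>p\<close> in almost every direction.
  Half-spaces are open, so their mass is left continuous in \<open>p\<close>; homogeneity makes the
  other side continuous, and approaching \<open>p\<close> from below through good values removes the
  exceptional set.\<close>

lemma AE_halfspace_params:
  fixes M :: "'a::euclidean_space measure"
  assumes M: "admissible_measure M"
    and ae: "AE z in halfspace_params_measure. measure M (halfspace (fst z) (snd z)) = a z"
    and homog: "\<And>\<omega> t p. \<omega> \<in> sphere 0 1 \<Longrightarrow> t > 0 \<Longrightarrow> p < 0 \<Longrightarrow>
                  a (\<omega>, t * p) = t powr (- \<beta>) * a (\<omega>, p)"
  shows "AE \<omega> in sphere_measure. \<forall>p<0. measure M (halfspace \<omega> p) = (-p) powr (-\<beta>) * a (\<omega>, -1)"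
proof -
  interpret S: prob_space "sphere_measure :: 'a measure" by (rule prob_space_sphere_measure)
  interpret R: sigma_finite_measure "restrict_space lborel {..<0::real}"
    by (intro sigma_finite_measure_restrict_space) (auto intro: lborel.sigma_finite_measure_axioms)
  interpret pair_sigma_finite "sphere_measure :: 'a measure" "restrict_space lborel {..<0::real}" ..
  have "AE \<omega> in sphere_measure. AE p in restrict_space lborel {..<0}. measure M (halfspace \<omega> p) = a (\<omega>, p)"
    using AE_pair[OF ae[unfolded halfspace_params_measure_def]] by simp
  moreover have "AE \<omega> in (sphere_measure :: 'a measure). \<omega> \<in> sphere 0 1"
    using AE_space[of "sphere_measure :: 'a measure"] by (simp add: space_sphere_measure)
  ultimately show ?thesis
  proof eventually_elim
    case (elim \<omega>)
    then have w: "norm \<omega> = 1" "\<omega> \<in> sphere 0 1" by auto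
    have "AE p in lborel. p < 0 \<longrightarrow> measure M (halfspace \<omega> p) = a (\<omega>, p)"
      using elim(1) by (subst (asm) AE_restrict_space_iff) auto
    then obtain N where N: "N \<in> null_sets lborel" "{p. \<not> (p < 0 \<longrightarrow> measure M (halfspace \<omega> p) = a (\<omega>, p))} \<subseteq> N"
      by (auto simp: eventually_ae_filter)
    show ?case
    proof safe
      fix p :: real assume p: "p < 0"
      \<comment> \<open>An interval of positive length is not contained in the null set
        \<open>N\<close>.\<close>
      have "\<exists>q. q \<notin> N \<and> p - 1 / Suc n < q \<and> q < p" for n :: nat
      proof (rule ccontr)
        assume "\<not> ?thesis"
        then have "{p - 1 / Suc n <..< p} \<subseteq> N" by auto
        then have "{p - 1 / Suc n <..< p} \<in> null_sets lborel"
          by (intro null_sets_subset[OF N(1)]) auto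
        then show False by (simp add: null_sets_def)
      qed
      then obtain q where q: "\<And>n. q n \<notin> N" "\<And>n. p - 1 / Suc n < q n" "\<And>n. q n < p" by metis
      have qlim: "q \<longlonglongrightarrow> p"
      proof (rule tendsto_sandwich[of "\<lambda>n. p - 1 / Suc n" _ _ "\<lambda>_. p"])
        show "(\<lambda>n. p - 1 / real (Suc n)) \<longlonglongrightarrow> p"
          using tendsto_diff[OF tendsto_const LIMSEQ_Suc[OF lim_1_over_n], of p] by simp
      qed (use q in \<open>auto intro!: always_eventually less_imp_le\<close>)
      have fin: "emeasure M (halfspace \<omega> p) < \<infinity>"
        using admissible_halfspace_finite[OF M w(1) p] .
      have sM: "sets M = sets borel" using M by (rule admissible_measure_sets)
      have int: "integral\<^sup>L M (indicator (halfspace \<omega> t) :: _ \<Rightarrow> real) = measure M (halfspace \<omega> t)" for t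
        using sM sets_eq_imp_space_eq[OF sM] by simp
      \<comment> \<open>The sequence \<open>q\<close> need not be monotone, so dominated convergence
        takes the place of continuity from below; the half-space at level \<open>p\<close> contains
        all the others.\<close>
      have "(\<lambda>n. \<integral>x. indicator (halfspace \<omega> (q n)) x \<partial>M) \<longlonglongrightarrow> (\<integral>x. indicator (halfspace \<omega> p) x \<partial>M :: real)"
      proof (rule integral_dominated_convergence[where w="indicator (halfspace \<omega> p)"])
        show "integrable M (indicator (halfspace \<omega> p) :: _ \<Rightarrow> real)"
          using fin sM by (simp add: integrable_indicator_iff)
        show "AE x in M. (\<lambda>n. indicator (halfspace \<omega> (q n)) x) \<longlonglongrightarrow> (indicator (halfspace \<omega> p) x :: real)"
        proof (rule AE_I2)
          fix x :: 'a
          show "(\<lambda>n. indicator (halfspace \<omega> (q n)) x) \<longlonglongrightarrow> (indicator (halfspace \<omega> p) x :: real)"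
          proof (cases "x \<bullet> \<omega> < p")
            case True
            have "eventually (\<lambda>n. x \<bullet> \<omega> < q n) sequentially" using order_tendstoD(1)[OF qlim True] .
            then show ?thesis using True
              by (intro tendsto_eventually) (auto elim!: eventually_mono simp: halfspace_def)
          next
            case False
            then show ?thesis using q(3)
              by (intro tendsto_eventually always_eventually) (auto simp: halfspace_def indicator_def intro: less_trans)
          qed
        qed
        show "\<And>n. AE x in M. norm (indicator (halfspace \<omega> (q n)) x :: real) \<le> indicator (halfspace \<omega> p) x"
          using q(3) by (intro AE_I2) (auto simp: halfspace_def indicator_def intro: less_trans)
      qed (use sM in \<open>auto cong: measurable_cong_sets\<close>)
      then have 1: "(\<lambda>n. measure M (halfspace \<omega> (q n))) \<longlonglongrightarrow> measure M (halfspace \<omega> p)"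
        unfolding int .
      have "measure M (halfspace \<omega> (q n)) = (- q n) powr (-\<beta>) * a (\<omega>, -1)" for n
      proof -
        have "q n < 0" using q(3)[of n] p by linarith
        then have "measure M (halfspace \<omega> (q n)) = a (\<omega>, (- q n) * (-1))" using N q(1)[of n] by auto
        also have "\<dots> = (- q n) powr (-\<beta>) * a (\<omega>, -1)" using \<open>q n < 0\<close> w by (intro homog) auto
        finally show ?thesis .
      qed
      moreover have "(\<lambda>n. (- q n) powr (-\<beta>) * a (\<omega>, -1)) \<longlonglongrightarrow> (- p) powr (-\<beta>) * a (\<omega>, -1)"
        using p by (intro tendsto_intros qlim) auto
      ultimately show "measure M (halfspace \<omega> p) = (- p) powr (-\<beta>) * a (\<omega>, -1)"
        using LIMSEQ_unique[OF 1] by simp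
    qed
  qed
qed

text \<open>Each unit vector \<open>u\<close> has a good direction near \<open>-u\<close>, so the
  open caps \<open>?U \<omega>\<close> around the antipodes of good directions cover the sphere;
  compactness leaves finitely many.\<close>

lemma AE_sphere_measure_finite_cover:
  fixes P :: "'a::euclidean_space \<Rightarrow> bool"
  assumes P: "AE \<omega> in sphere_measure. P \<omega>"
  obtains F where "finite F" "\<And>\<omega>. \<omega> \<in> F \<Longrightarrow> norm \<omega> = 1" "\<And>\<omega>. \<omega> \<in> F \<Longrightarrow> P \<omega>"
    "\<And>x. x \<noteq> 0 \<Longrightarrow> \<exists>\<omega>\<in>F. x \<bullet> \<omega> < - norm x / 2"
proof -
  let ?Om = "{\<omega>::'a. norm \<omega> = 1 \<and> P \<omega>}"
  let ?U = "\<lambda>\<omega>. {u::'a. u \<bullet> \<omega> < - 1 / 2}"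
  have "sphere 0 1 \<subseteq> (\<Union>\<omega>\<in>?Om. ?U \<omega>)"
  proof
    fix u :: 'a assume u: "u \<in> sphere 0 1"
    \<comment> \<open>With radius 1/4 one gets \<open>u \<bullet> y < - 3/4\<close> and
      \<open>norm y < 5/4\<close>, so the normalized product stays below -3/5, hence below
      -1/2.\<close>
    obtain y where y: "y \<in> ball (-u) (1/4)" "y \<noteq> 0" "P (sgn y)"
      by (rule AE_sphere_measure_dense[OF P, of "ball (-u) (1/4)"]) auto
    have "norm (y + u) < 1/4" using y(1) by (simp add: dist_norm norm_minus_commute)
    moreover have "u \<bullet> (y + u) \<le> norm (y + u)" using u norm_cauchy_schwarz[of u "y + u"] by simp
    moreover have "u \<bullet> u = 1" using u by (simp add: dot_square_norm)
    ultimately have 1: "u \<bullet> y < - 3/4" by (simp add: inner_add_right)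
    have "norm y \<le> norm (y + u) + norm u" by (metis add_diff_cancel norm_triangle_ineq4)
    then have 2: "norm y < 5/4" using \<open>norm (y + u) < 1/4\<close> u by simp
    have "u \<bullet> sgn y = (u \<bullet> y) / norm y" by (simp add: sgn_div_norm divide_inverse)
    also have "\<dots> < - 1 / 2" using 1 2 y(2) by (simp add: divide_simps)
    finally show "u \<in> (\<Union>\<omega>\<in>?Om. ?U \<omega>)" using y by (auto simp: norm_sgn intro!: exI[of _ "sgn y"])
  qed
  note cover = this
  have op: "open (?U \<omega>)" for \<omega> by (intro open_Collect_less continuous_intros)
  obtain F where F: "F \<subseteq> ?Om" "finite F" "sphere 0 1 \<subseteq> (\<Union>\<omega>\<in>F. ?U \<omega>)"
    by (rule compactE_image[OF compact_sphere op cover])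
  show ?thesis
  proof (rule that[of F])
    fix x :: 'a assume x: "x \<noteq> 0"
    then have "sgn x \<in> sphere 0 1" by (simp add: norm_sgn)
    then obtain w where w: "w \<in> F" "sgn x \<bullet> w < - 1 / 2" using F(3) by blast
    have "x \<bullet> w = norm x * (sgn x \<bullet> w)" using x by (simp add: sgn_div_norm)
    also have "\<dots> < norm x * (-1/2)" using x w by (intro mult_strict_left_mono) auto
    finally show "\<exists>\<omega>\<in>F. x \<bullet> \<omega> < - norm x / 2" using w(1) by auto
  qed (use F in auto)
qed

text \<open>Finitely many good half-spaces at level \<open>- r / 2\<close> cover the tail, and the
  mass of each scales like \<open>r powr (-\<beta>)\<close>. Non-negativity of the measure enters
  through monotonicity and subadditivity.\<close>

lemma admissible_tail_bound:
  fixes M :: "'a::euclidean_space measure"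
  assumes M: "admissible_measure M"
    and A: "AE \<omega> in sphere_measure. \<forall>p<0. measure M (halfspace \<omega> p) = (-p) powr (-\<beta>) * A \<omega>"
  obtains C where "C \<ge> 0" "\<And>r. r > 0 \<Longrightarrow> emeasure M {x. r \<le> norm x} \<le> ennreal (C * r powr (-\<beta>))"
proof -
  obtain F where F: "finite F" "\<And>\<omega>. \<omega> \<in> F \<Longrightarrow> norm \<omega> = 1"
    "\<And>\<omega>. \<omega> \<in> F \<Longrightarrow> \<forall>p<0. measure M (halfspace \<omega> p) = (-p) powr (-\<beta>) * A \<omega>"
    "\<And>x. x \<noteq> 0 \<Longrightarrow> \<exists>\<omega>\<in>F. x \<bullet> \<omega> < - norm x / 2"
    by (rule AE_sphere_measure_finite_cover[OF A]) (rule that)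
  have sM: "sets M = sets borel" using M by (rule admissible_measure_sets)
  show ?thesis
  proof (rule that)
    show "(\<Sum>\<omega>\<in>F. 2 powr \<beta> * \<bar>A \<omega>\<bar>) \<ge> 0" by (intro sum_nonneg) auto
    fix r :: real assume r: "r > 0"
    have "{x. r \<le> norm x} \<subseteq> (\<Union>\<omega>\<in>F. halfspace \<omega> (- r / 2))"
    proof
      fix x :: 'a assume x: "x \<in> {x. r \<le> norm x}"
      with r have "x \<noteq> 0" by auto
      from F(4)[OF this] x show "x \<in> (\<Union>\<omega>\<in>F. halfspace \<omega> (- r / 2))"
        by (force simp: halfspace_def)
    qed
    then have "emeasure M {x. r \<le> norm x} \<le> emeasure M (\<Union>\<omega>\<in>F. halfspace \<omega> (- r / 2))"
      using F(1) by (intro emeasure_mono sets.finite_UN) (auto simp: sM)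
    also have "\<dots> \<le> (\<Sum>\<omega>\<in>F. emeasure M (halfspace \<omega> (- r / 2)))"
      using F(1) by (intro emeasure_subadditive_finite) (auto simp: sM)
    also have "\<dots> \<le> (\<Sum>\<omega>\<in>F. ennreal (2 powr \<beta> * \<bar>A \<omega>\<bar> * r powr (-\<beta>)))"
    proof (rule sum_mono)
      fix \<omega> assume w: "\<omega> \<in> F"
      \<comment> \<open>Finiteness matters: \<open>measure\<close> takes the default value 0 on sets
        of infinite mass, where it would bound nothing.\<close>
      have "emeasure M (halfspace \<omega> (- r / 2)) = ennreal (measure M (halfspace \<omega> (- r / 2)))"
        using admissible_halfspace_finite[OF M F(2)[OF w], of "- r / 2"] r
        by (intro emeasure_eq_ennreal_measure) auto
      also have "measure M (halfspace \<omega> (- r / 2)) = (r / 2) powr (-\<beta>) * A \<omega>"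
        using F(3)[OF w] r by auto
      also have "\<dots> \<le> 2 powr \<beta> * \<bar>A \<omega>\<bar> * r powr (-\<beta>)"
        using r by (auto simp: powr_divide powr_minus divide_simps mult.commute)
      finally show "emeasure M (halfspace \<omega> (- r / 2)) \<le> ennreal (2 powr \<beta> * \<bar>A \<omega>\<bar> * r powr (-\<beta>))"
        by (simp add: ennreal_leI)
    qed
    also have "\<dots> = ennreal ((\<Sum>\<omega>\<in>F. 2 powr \<beta> * \<bar>A \<omega>\<bar>) * r powr (-\<beta>))"
      by (simp add: sum_ennreal sum_distrib_right)
    finally show "emeasure M {x. r \<le> norm x} \<le> ennreal ((\<Sum>\<omega>\<in>F. 2 powr \<beta> * \<bar>A \<omega>\<bar>) * r powr (-\<beta>))" .
  qed
qed

text \<open>A discrete layer-cake estimate: integrating the majorant term by term against the tail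
  bound leaves a multiple of the geometric series with ratio \<open>q\<close>. It serves both the
  region near the origin and the region near infinity.\<close>

lemma nn_integral_dyadic_tail_finite:
  fixes M :: "'a::euclidean_space measure" and f :: "'a \<Rightarrow> ennreal"
  assumes M: "sets M = sets borel" and C: "C \<ge> 0"
    and tail: "\<And>r. r > 0 \<Longrightarrow> emeasure M {x. r \<le> norm x} \<le> ennreal (C * r powr (-\<beta>))"
    and c: "\<And>n. c n \<ge> 0" and r: "\<And>n. r n > 0"
    and geo: "\<And>n. c n * r n powr (-\<beta>) = K * q ^ n" "\<bar>q\<bar> < 1"
    and f: "\<And>x. f x \<le> (\<Sum>n. ennreal (c n) * indicator {x. r n \<le> norm x} x)"
  shows "(\<integral>\<^sup>+x. f x \<partial>M) < \<infinity>"
proof -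
  have [measurable_cong]: "sets M = sets borel" by (rule M)
  have m: "{x::'a. r n \<le> norm x} \<in> sets M" for n by (simp add: M)
  have s: "summable (\<lambda>n. C * (K * q ^ n))" using geo(2) by (intro summable_mult summable_geometric) simp
  have nn: "0 \<le> C * (K * q ^ n)" for n
    unfolding geo(1)[symmetric] using C c by auto
  have "(\<integral>\<^sup>+x. f x \<partial>M) \<le> (\<integral>\<^sup>+x. (\<Sum>n. ennreal (c n) * indicator {x. r n \<le> norm x} x) \<partial>M)"
    by (intro nn_integral_mono f)
  also have "\<dots> = (\<Sum>n. \<integral>\<^sup>+x. ennreal (c n) * indicator {x. r n \<le> norm x} x \<partial>M)"
    using m by (intro nn_integral_suminf) auto
  also have "\<dots> = (\<Sum>n. ennreal (c n) * emeasure M {x. r n \<le> norm x})"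
    using m by (simp add: nn_integral_cmult_indicator)
  also have "\<dots> \<le> (\<Sum>n. ennreal (C * (K * q ^ n)))"
  proof (intro suminf_le allI)
    fix n
    have "ennreal (c n) * emeasure M {x. r n \<le> norm x} \<le> ennreal (c n) * ennreal (C * r n powr (-\<beta>))"
      by (intro mult_left_mono tail r) auto
    also have "\<dots> = ennreal (C * (K * q ^ n))"
      unfolding geo(1)[symmetric] using c by (simp add: ennreal_mult'[symmetric] mult_ac)
    finally show "ennreal (c n) * emeasure M {x. r n \<le> norm x} \<le> ennreal (C * (K * q ^ n))" .
  qed auto
  also have "\<dots> < \<infinity>" using suminf_ennreal_eq[OF nn summable_sums[OF s]] by simp
  finally show ?thesis .
qed

lemma le_suminf_single:
  fixes g :: "nat \<Rightarrow> ennreal"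
  assumes "y \<le> g n" shows "y \<le> (\<Sum>n. g n)"
  using order_trans[OF assms] sum_le_suminf[OF summableI, of "{n}" g] by simp

text \<open>The minimum is \<open>norm x ^ k\<close> outside the unit ball and
  \<open>norm x ^ Suc k\<close> inside. The dyadic series have ratios
  \<open>2 powr (real k - \<beta>)\<close> and \<open>2 powr (\<beta> - Suc k)\<close>; both are
  below 1 exactly because \<beta> lies strictly between consecutive integers.\<close>

lemma integrable_min_power_norm:
  fixes M :: "'a::euclidean_space measure"
  assumes M: "sets M = sets borel" and C: "C \<ge> 0"
    and tail: "\<And>r. r > 0 \<Longrightarrow> emeasure M {x. r \<le> norm x} \<le> ennreal (C * r powr (-\<beta>))"
    and k: "real k < \<beta>" "\<beta> < real (Suc k)"
  shows "integrable M (\<lambda>x. min (norm x ^ k) (norm x ^ Suc k))"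
proof (rule integrableI_bounded)
  have [measurable_cong]: "sets M = sets borel" by (rule M)
  show "(\<lambda>x. min (norm x ^ k) (norm x ^ Suc k)) \<in> borel_measurable M" by measurable
  define g where "g x = ennreal (norm (min (norm x ^ k) (norm x ^ Suc k)))" for x :: 'a
  have g: "g x = ennreal (min (norm x ^ k) (norm x ^ Suc k))" for x
    unfolding g_def by (simp add: min_def)
  have gm[measurable]: "g \<in> borel_measurable M" unfolding g_def by measurable
  have big: "(\<integral>\<^sup>+x. g x * indicator {x. 1 \<le> norm x} x \<partial>M) < \<infinity>"
  \<comment> \<open>On the shell from \<open>2 ^ n\<close> to \<open>2 ^ Suc n\<close> the outer
    radius bounds the integrand and the inner radius determines the tail.\<close>
  proof (rule nn_integral_dyadic_tail_finite[OF M C tail, of "\<lambda>n. (2 ^ Suc n) ^ k" "\<lambda>n. 2 ^ n" "2 ^ k" "2 ^ k * 2 powr (-\<beta>)"])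
    show "(2 ^ Suc n) ^ k * (2 ^ n) powr - \<beta> = (2 ^ k * (2 ^ k * 2 powr - \<beta>) ^ n :: real)" for n
    proof -
      have "(2 ^ n) powr - \<beta> = (2 powr - \<beta>) ^ n"
        by (simp add: powr_power powr_realpow[symmetric] powr_powr mult.commute del: powr_realpow)
      moreover have "(2 ^ Suc n) ^ k = (2 ^ k * (2 ^ k) ^ n :: real)"
        by (simp add: power_mult_distrib power_mult[symmetric] mult.commute)
      ultimately show ?thesis by (simp only: power_mult_distrib mult_ac)
    qed
    have "2 ^ k * 2 powr (-\<beta>) = 2 powr (real k - \<beta>)"
      by (simp add: powr_diff powr_minus powr_realpow divide_inverse)
    also have "\<dots> < 2 powr 0" using k by (intro powr_less_mono) auto
    finally show "\<bar>2 ^ k * 2 powr (-\<beta>)\<bar> < 1" by simp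
    fix x :: 'a
    show "g x * indicator {x. 1 \<le> norm x} x \<le> (\<Sum>n. ennreal ((2 ^ Suc n) ^ k) * indicator {x. 2 ^ n \<le> norm x} x)"
    proof (cases "1 \<le> norm x")
      case True
      define n where "n = (LEAST n. norm x < 2 ^ Suc n)"
      have ex: "\<exists>n. norm x < 2 ^ Suc n"
      proof -
        obtain m where "norm x < 2 ^ m" using real_arch_pow[of 2 "norm x"] by auto
        also have "\<dots> \<le> 2 ^ Suc m" by simp
        finally show ?thesis by blast
      qed
      have 1: "norm x < 2 ^ Suc n" unfolding n_def by (rule LeastI_ex[OF ex])
      have 2: "2 ^ n \<le> norm x"
      proof (cases n)
        case 0 then show ?thesis using True by simp
      next
        case (Suc m)
        then have "\<not> norm x < 2 ^ Suc m" using not_less_Least[of m "\<lambda>n. norm x < 2 ^ Suc n"] n_def by simp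
        then show ?thesis using Suc by simp
      qed
      have "norm x ^ k \<le> (2 ^ Suc n) ^ k" using 1 by (intro power_mono) auto
      then have "g x \<le> ennreal ((2 ^ Suc n) ^ k)" unfolding g by (intro ennreal_leI) (auto simp: min_def)
      then show ?thesis using True 2 by (intro le_suminf_single[of _ _ n]) (auto simp del: power_Suc)
    qed simp
  qed auto
  have small: "(\<integral>\<^sup>+x. g x * indicator {x. norm x < 1} x \<partial>M) < \<infinity>"
  \<comment> \<open>The shells now shrink to the origin, so the inner radius, which determines the
    tail, is the one with exponent \<open>Suc n\<close>.\<close>
  proof (rule nn_integral_dyadic_tail_finite[OF M C tail, of "\<lambda>n. ((1/2) ^ n) ^ Suc k" "\<lambda>n. (1/2) ^ Suc n" "2 powr \<beta>" "(1/2) ^ Suc k * 2 powr \<beta>"])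
    show "((1/2) ^ n) ^ Suc k * ((1/2) ^ Suc n) powr - \<beta> = 2 powr \<beta> * ((1/2) ^ Suc k * 2 powr \<beta>) ^ n" for n
    proof -
      have "((1/2::real) ^ Suc n) powr - \<beta> = (2 ^ Suc n) powr \<beta>"
        by (simp add: power_one_over powr_minus powr_divide del: power_Suc)
      also have "\<dots> = 2 powr \<beta> * (2 powr \<beta>) ^ n"
        by (simp add: powr_mult powr_power powr_realpow[symmetric] powr_powr mult.commute del: powr_realpow)
      finally show ?thesis 
        by (simp add: power_mult_distrib power_mult[symmetric] mult.commute del: power_Suc) 
    qed
    have "(1/2) ^ Suc k * 2 powr \<beta> = 2 powr (\<beta> - Suc k)"
    proof -
      have "2 powr (\<beta> - Suc k) = 2 powr \<beta> / 2 powr real (Suc k)" by (rule powr_diff)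
      also have "2 powr real (Suc k) = (2::real) ^ Suc k" by (rule powr_realpow) simp
      finally show ?thesis by (simp add: power_divide del: power_Suc)
    qed
    also have "\<dots> < 2 powr 0" using k by (intro powr_less_mono) auto
    finally show "\<bar>(1/2) ^ Suc k * 2 powr \<beta>\<bar> < 1" by simp
    fix x :: 'a
    show "g x * indicator {x. norm x < 1} x \<le> (\<Sum>n. ennreal (((1/2) ^ n) ^ Suc k) * indicator {x. (1/2) ^ Suc n \<le> norm x} x)"
    proof (cases "norm x < 1 \<and> x \<noteq> 0")
      case True
      define n where "n = (LEAST n. (1/2) ^ Suc n \<le> norm x)"
      have "\<exists>n. (1/2) ^ n < norm x" using real_arch_pow_inv[of "norm x" "1/2"] True by auto
      then obtain m where m: "(1/2) ^ m < norm x" by auto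
      have "(1/2) ^ Suc m \<le> (1/2::real) ^ m" by simp
      with m have ex: "\<exists>n. (1/2) ^ Suc n \<le> norm x" by (intro exI[of _ m]) linarith
      have 1: "(1/2) ^ Suc n \<le> norm x" unfolding n_def by (rule LeastI_ex[OF ex])
      have 2: "norm x \<le> (1/2) ^ n"
      proof (cases n)
        case 0 then show ?thesis using True by simp
      next
        case (Suc m)
        then have "\<not> (1/2) ^ Suc m \<le> norm x" using not_less_Least[of m "\<lambda>n. (1/2) ^ Suc n \<le> norm x"] n_def by simp
        then show ?thesis using Suc by simp
      qed
      have "norm x ^ Suc k \<le> ((1/2) ^ n) ^ Suc k" using 2 by (intro power_mono) auto
      then have "g x \<le> ennreal (((1/2) ^ n) ^ Suc k)" unfolding g by (intro ennreal_leI) (auto simp: min_def)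
      then show ?thesis using True 1 by (intro le_suminf_single[of _ _ n]) (auto simp del: power_Suc)
    next
      case False
      \<comment> \<open>The origin lies in no tail, so the majorant vanishes there. So does the
        integrand, even for \<open>k = 0\<close>, where \<open>0 ^ k = 1\<close> but the second
        power is 0.\<close>
      have "g 0 = 0" by (cases k) (auto simp: g)
      with False show ?thesis by (cases "x = 0") auto
    qed
  qed auto
  have "(\<integral>\<^sup>+x. g x \<partial>M) = (\<integral>\<^sup>+x. g x * indicator {x. 1 \<le> norm x} x + g x * indicator {x. norm x < 1} x \<partial>M)"
    by (intro nn_integral_cong) (auto simp: indicator_def)
  also have "\<dots> = (\<integral>\<^sup>+x. g x * indicator {x. 1 \<le> norm x} x \<partial>M) + (\<integral>\<^sup>+x. g x * indicator {x. norm x < 1} x \<partial>M)"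
    by (intro nn_integral_add) auto
  finally show "(\<integral>\<^sup>+x. ennreal (norm (min (norm x ^ k) (norm x ^ Suc k))) \<partial>M) < \<infinity>"
    using big small by (simp add: g_def)
qed

section \<open>Ridge functions\<close>

text \<open>Integrability is part of the notion because the Bochner integral of a non-integrable
  function is 0 by convention; equality of integrals alone would not be closed under sums.\<close>

definition same_integral :: "'a measure \<Rightarrow> 'a measure \<Rightarrow> ('a \<Rightarrow> 'b::{banach,second_countable_topology}) \<Rightarrow> bool" where
  "same_integral M N f \<longleftrightarrow> integrable M f \<and> integrable N f \<and> integral\<^sup>L M f = integral\<^sup>L N f"

lemma same_integral_add:
  "same_integral M N f \<Longrightarrow> same_integral M N g \<Longrightarrow> same_integral M N (\<lambda>x. f x + g x)"
  by (simp add: same_integral_def)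

lemma same_integral_diff:
  "same_integral M N f \<Longrightarrow> same_integral M N g \<Longrightarrow> same_integral M N (\<lambda>x. f x - g x)"
  by (simp add: same_integral_def)

lemma same_integral_mult:
  fixes f :: "'a \<Rightarrow> 'b::{banach,second_countable_topology,real_normed_field}"
  shows "same_integral M N f \<Longrightarrow> same_integral M N (\<lambda>x. c * f x)"
  by (simp add: same_integral_def)

lemma same_integral_sum:
  "(\<And>i. i \<in> I \<Longrightarrow> same_integral M N (f i)) \<Longrightarrow> same_integral M N (\<lambda>x. \<Sum>i\<in>I. f i x)"
  by (simp add: same_integral_def)

lemma same_integral_Re: "same_integral M N f \<Longrightarrow> same_integral M N (\<lambda>x. Re (f x))"
  by (simp add: same_integral_def)

text \<open>Cutting at distance \<open>e\<close> from the origin makes the projected measures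
  finite, so the masses of rays determine them, and the preimage of a ray is again a half-space, at
  level \<open>min (-e) (-q)\<close>. The sign in \<open>- (x \<bullet> \<omega>)\<close> turns
  half-spaces into upper rays.\<close>

lemma distr_halfline_eq:
  fixes M N :: "'a::euclidean_space measure"
  assumes M: "admissible_measure M" and N: "admissible_measure N" and w: "norm \<omega> = 1"
    and eq: "\<And>p. p < 0 \<Longrightarrow> measure M (halfspace \<omega> p) = measure N (halfspace \<omega> p)" and e: "e > 0"
  shows "distr (density M (\<lambda>x. ennreal (indicator (halfspace \<omega> (-e)) x))) borel (\<lambda>x. - (x \<bullet> \<omega>))
       = distr (density N (\<lambda>x. ennreal (indicator (halfspace \<omega> (-e)) x))) borel (\<lambda>x. - (x \<bullet> \<omega>))"
proof (rule measure_eqI_lessThan)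
  have *: "emeasure (distr (density L (\<lambda>x. ennreal (indicator (halfspace \<omega> (-e)) x))) borel (\<lambda>x. - (x \<bullet> \<omega>))) {q<..}
    = emeasure L (halfspace \<omega> (min (-e) (-q)))" if "admissible_measure L" for L q
  proof -
    have sL[measurable_cong]: "sets L = sets borel" using that by (rule admissible_measure_sets)
    then have spL: "space L = UNIV" using sets_eq_imp_space_eq by force
    have "emeasure (distr (density L (\<lambda>x. ennreal (indicator (halfspace \<omega> (-e)) x))) borel (\<lambda>x. - (x \<bullet> \<omega>))) {q<..}
      = emeasure (density L (\<lambda>x. ennreal (indicator (halfspace \<omega> (-e)) x))) {x. - (x \<bullet> \<omega>) > q}"
      by (subst emeasure_distr) (auto simp: spL intro!: arg_cong[where f="emeasure _"])
    also have "\<dots> = (\<integral>\<^sup>+x. ennreal (indicator (halfspace \<omega> (-e)) x) * indicator {x. - (x \<bullet> \<omega>) > q} x \<partial>L)"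
      by (subst emeasure_density) auto
    also have "\<dots> = (\<integral>\<^sup>+x. indicator (halfspace \<omega> (min (-e) (-q))) x \<partial>L)"
      by (intro nn_integral_cong) (auto simp: halfspace_def indicator_def)
    also have "\<dots> = emeasure L (halfspace \<omega> (min (-e) (-q)))"
      by (intro nn_integral_indicator) (simp add: sL)
    finally show ?thesis .
  qed
  fix q
  have neg: "min (-e) (-q) < 0" using e by auto
  note fin = admissible_halfspace_finite[OF M w neg] admissible_halfspace_finite[OF N w neg]
  show "emeasure (distr (density M (\<lambda>x. ennreal (indicator (halfspace \<omega> (-e)) x))) borel (\<lambda>x. - (x \<bullet> \<omega>))) {q<..} < \<infinity>"
    unfolding *[OF M] by (rule fin)
  have "emeasure M (halfspace \<omega> (min (-e) (-q))) = emeasure N (halfspace \<omega> (min (-e) (-q)))"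
    using fin eq[OF neg] by (simp add: emeasure_eq_ennreal_measure less_top)
  then show "emeasure (distr (density M (\<lambda>x. ennreal (indicator (halfspace \<omega> (-e)) x))) borel (\<lambda>x. - (x \<bullet> \<omega>))) {q<..}
    = emeasure (distr (density N (\<lambda>x. ennreal (indicator (halfspace \<omega> (-e)) x))) borel (\<lambda>x. - (x \<bullet> \<omega>))) {q<..}"
    unfolding *[OF M] *[OF N] .
qed auto

text \<open>The truncated integrals depend only on the truncated projections and hence agree. As the
  cut tends to 0, dominated convergence recovers the full integrals, since \<open>h\<close> vanishes
  on the non-negative half-line.\<close>

lemma integral_halfline_eq:
  fixes M N :: "'a::euclidean_space measure" and h :: "real \<Rightarrow> complex"
  assumes M: "admissible_measure M" and N: "admissible_measure N" and w: "norm \<omega> = 1"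
    and eq: "\<And>p. p < 0 \<Longrightarrow> measure M (halfspace \<omega> p) = measure N (halfspace \<omega> p)"
    and h[measurable]: "h \<in> borel_measurable borel" and h0: "\<And>s. s \<ge> 0 \<Longrightarrow> h s = 0"
    and int: "integrable M (\<lambda>x. h (x \<bullet> \<omega>))" "integrable N (\<lambda>x. h (x \<bullet> \<omega>))"
  shows "(\<integral>x. h (x \<bullet> \<omega>) \<partial>M) = (\<integral>x. h (x \<bullet> \<omega>) \<partial>N)"
proof -
  let ?I = "\<lambda>n x. indicator (halfspace \<omega> (- (1 / real (Suc n)))) x :: real"
  have lim: "(\<lambda>n. \<integral>x. ?I n x *\<^sub>R h (x \<bullet> \<omega>) \<partial>L) \<longlonglongrightarrow> (\<integral>x. h (x \<bullet> \<omega>) \<partial>L)"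
    if "admissible_measure L" "integrable L (\<lambda>x. h (x \<bullet> \<omega>))" for L
  proof (rule integral_dominated_convergence[where w="\<lambda>x. norm (h (x \<bullet> \<omega>))"])
    have [measurable_cong]: "sets L = sets borel" using that(1) by (rule admissible_measure_sets)
    show "(\<lambda>x. h (x \<bullet> \<omega>)) \<in> borel_measurable L" "\<And>n. (\<lambda>x. ?I n x *\<^sub>R h (x \<bullet> \<omega>)) \<in> borel_measurable L"
      by measurable
    show "integrable L (\<lambda>x. norm (h (x \<bullet> \<omega>)))" using that by simp
    show "AE x in L. norm (?I n x *\<^sub>R h (x \<bullet> \<omega>)) \<le> norm (h (x \<bullet> \<omega>))" for n
      by (intro AE_I2) (auto simp: indicator_def)
    show "AE x in L. (\<lambda>n. ?I n x *\<^sub>R h (x \<bullet> \<omega>)) \<longlonglongrightarrow> h (x \<bullet> \<omega>)"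
    proof (rule AE_I2)
      fix x :: 'a
      show "(\<lambda>n. ?I n x *\<^sub>R h (x \<bullet> \<omega>)) \<longlonglongrightarrow> h (x \<bullet> \<omega>)"
      proof (cases "x \<bullet> \<omega> < 0")
        case True
        have "(\<lambda>n. - (1 / real (Suc n))) \<longlonglongrightarrow> - 0"
          by (intro tendsto_intros LIMSEQ_Suc[OF lim_1_over_n])
        then have "eventually (\<lambda>n. x \<bullet> \<omega> < - (1 / real (Suc n))) sequentially"
          using True by (intro order_tendstoD(1)[of _ 0]) auto
        then show ?thesis
          by (intro tendsto_eventually) (auto elim!: eventually_mono simp: halfspace_def)
      qed (use h0 in auto)
    qed
  qed
  have "(\<integral>x. ?I n x *\<^sub>R h (x \<bullet> \<omega>) \<partial>M) = (\<integral>x. ?I n x *\<^sub>R h (x \<bullet> \<omega>) \<partial>N)" for n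
  proof -
    \<comment> \<open>The argument \<open>- s\<close> undoes the sign in the projection.\<close>
    have *: "(\<integral>x. ?I n x *\<^sub>R h (x \<bullet> \<omega>) \<partial>L) = 
      (\<integral>s. h (- s) \<partial>distr (density L (\<lambda>x. ennreal (?I n x))) borel (\<lambda>x. - (x \<bullet> \<omega>)))"
      if "admissible_measure L" for L
    proof -
      have [measurable_cong]: "sets L = sets borel" using that(1) by (rule admissible_measure_sets)
      show ?thesis by (simp add: integral_distr integral_density)
    qed
    show ?thesis unfolding *[OF M] *[OF N]
      by (subst distr_halfline_eq[OF M N w eq]) auto
  qed
  then show ?thesis using LIMSEQ_unique[OF lim[OF M int(1)]] lim[OF N int(2)] by simp
qed

text \<open>The setting of the uniqueness argument: the function \<open>a\<close> and the degree are
  replaced by equal half-space masses in almost every direction and by integrability of the two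
  growth rates.\<close>

locale halfspace_equal =
  fixes M N :: "'a::euclidean_space measure" and k :: nat
  assumes M: "admissible_measure M" and N: "admissible_measure N"
    and halfspaces: "AE \<omega> in sphere_measure. \<forall>p<0. measure M (halfspace \<omega> p) = measure N (halfspace \<omega> p)"
    and int_M: "integrable M (\<lambda>x. min (norm x ^ k) (norm x ^ Suc k))"
    and int_N: "integrable N (\<lambda>x. min (norm x ^ k) (norm x ^ Suc k))"
begin

lemma sets_M[measurable_cong]: "sets M = sets borel" and sets_N[measurable_cong]: "sets N = sets borel"
  using M N by (auto simp: admissible_measure_sets)

text \<open>Cauchy-Schwarz with the factor \<open>1 + B\<close>, which is at least 1 so that its
  power \<open>Suc k\<close> dominates its power \<open>k\<close>. The bound depends on \<xi> only
  through \<open>B\<close>, so it dominates uniformly along a convergent sequence of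
  vectors.\<close>

lemma ridge_bound:
  fixes h :: "real \<Rightarrow> complex"
  assumes bd: "\<And>s. norm (h s) \<le> C * min (\<bar>s\<bar> ^ k) (\<bar>s\<bar> ^ Suc k)" and C: "C \<ge> 0" and B: "norm \<xi> \<le> B"
  shows "norm (h (x \<bullet> \<xi>)) \<le> (C * (1 + B) ^ Suc k) * min (norm x ^ k) (norm x ^ Suc k)"
proof -
  have B0: "B \<ge> 0" using B norm_ge_zero[of \<xi>] by linarith
  have "\<bar>x \<bullet> \<xi>\<bar> \<le> norm x * norm \<xi>" by (rule Cauchy_Schwarz_ineq2)
  also have "\<dots> \<le> norm x * (1 + B)" using B by (intro mult_left_mono) auto
  finally have le: "\<bar>x \<bullet> \<xi>\<bar> \<le> norm x * (1 + B)" .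
  have "\<bar>x \<bullet> \<xi>\<bar> ^ k \<le> (norm x * (1 + B)) ^ k" using le by (intro power_mono) auto
  also have "\<dots> = norm x ^ k * (1 + B) ^ k" by (rule power_mult_distrib)
  also have "\<dots> \<le> norm x ^ k * (1 + B) ^ Suc k" using B0 by (intro mult_left_mono power_increasing) auto
  finally have 1: "\<bar>x \<bullet> \<xi>\<bar> ^ k \<le> (1 + B) ^ Suc k * norm x ^ k" by (simp add: mult.commute)
  have "\<bar>x \<bullet> \<xi>\<bar> ^ Suc k \<le> (norm x * (1 + B)) ^ Suc k" using le by (intro power_mono) auto
  also have "\<dots> = (1 + B) ^ Suc k * norm x ^ Suc k" by (simp only: power_mult_distrib mult.commute)
  finally have 2: "\<bar>x \<bullet> \<xi>\<bar> ^ Suc k \<le> (1 + B) ^ Suc k * norm x ^ Suc k" .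
  have "min (\<bar>x \<bullet> \<xi>\<bar> ^ k) (\<bar>x \<bullet> \<xi>\<bar> ^ Suc k) \<le> (1 + B) ^ Suc k * min (norm x ^ k) (norm x ^ Suc k)"
    using 1 2 unfolding min_def by (auto simp del: power_Suc)
  then have "C * min (\<bar>x \<bullet> \<xi>\<bar> ^ k) (\<bar>x \<bullet> \<xi>\<bar> ^ Suc k) \<le> C * ((1 + B) ^ Suc k * min (norm x ^ k) (norm x ^ Suc k))"
    using C by (intro mult_left_mono)
  then show ?thesis using bd[of "x \<bullet> \<xi>"] by (simp only: mult.assoc) 
qed

lemma ridge_integrable:
  fixes h :: "real \<Rightarrow> complex"
  assumes h: "continuous_on UNIV h"
    and bd: "\<And>s. norm (h s) \<le> C * min (\<bar>s\<bar> ^ k) (\<bar>s\<bar> ^ Suc k)" and C: "C \<ge> 0"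
  shows "integrable M (\<lambda>x. h (x \<bullet> \<xi>))" "integrable N (\<lambda>x. h (x \<bullet> \<xi>))"
proof -
  have [measurable]: "h \<in> borel_measurable borel" using h by (rule borel_measurable_continuous_onI)
  have le: "norm (h (x \<bullet> \<xi>)) \<le> norm ((C * (1 + norm \<xi>) ^ Suc k) * min (norm x ^ k) (norm x ^ Suc k))" for x
    using ridge_bound[of h C \<xi> "norm \<xi>", OF bd C] by (auto intro: order_trans[OF _ abs_ge_self])
  show "integrable M (\<lambda>x. h (x \<bullet> \<xi>))" 
    by (rule Bochner_Integration.integrable_bound[OF integrable_mult_right[OF int_M]])
      (use le in auto)
  show "integrable N (\<lambda>x. h (x \<bullet> \<xi>))" 
    by (rule Bochner_Integration.integrable_bound[OF integrable_mult_right[OF int_N]])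
      (use le in auto)
qed

text \<open>Equality is known for vectors pointing in good directions, which are dense; dominated
  convergence extends it to every \<xi>.\<close>

lemma same_integral_halfridge:
  fixes h :: "real \<Rightarrow> complex"
  assumes h: "continuous_on UNIV h" and h0: "\<And>s. s \<ge> 0 \<Longrightarrow> h s = 0"
    and bd: "\<And>s. norm (h s) \<le> C * min (\<bar>s\<bar> ^ k) (\<bar>s\<bar> ^ Suc k)" and C: "C \<ge> 0"
  shows "same_integral M N (\<lambda>x. h (x \<bullet> \<xi>))"
proof -
  have hm[measurable]: "h \<in> borel_measurable borel" using h by (rule borel_measurable_continuous_onI)
  let ?P = "\<lambda>\<omega>. norm \<omega> = 1 \<and> (\<forall>p<0. measure M (halfspace \<omega> p) = measure N (halfspace \<omega> p))"
  have "AE \<omega> in (sphere_measure :: 'a measure). \<omega> \<in> sphere 0 1"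
    using AE_space[of "sphere_measure :: 'a measure"] by (simp add: space_sphere_measure)
  with halfspaces have P: "AE \<omega> in sphere_measure. ?P \<omega>" by eventually_elim auto
  have "\<exists>y. dist y \<xi> < 1 / Suc n \<and> y \<noteq> 0 \<and> ?P (sgn y)" for n
    by (rule AE_sphere_measure_dense[OF P, of "ball \<xi> (1 / Suc n)"]) (auto simp: dist_commute)
  then obtain y where y: "\<And>n. dist (y n) \<xi> < 1 / Suc n" "\<And>n. y n \<noteq> 0" "\<And>n. ?P (sgn (y n))"
    by metis
  have ylim: "y \<longlonglongrightarrow> \<xi>"
  proof (rule metric_tendsto_imp_tendsto)
    show "(\<lambda>n. 1 / real (Suc n)) \<longlonglongrightarrow> 0" by (intro LIMSEQ_Suc[OF lim_1_over_n])
    show "\<forall>\<^sub>F n in sequentially. dist (y n) \<xi> \<le> dist (1 / real (Suc n)) 0"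
      using y(1) by (intro always_eventually) (auto intro: less_imp_le)
  qed
  have yB: "norm (y n) \<le> norm \<xi> + 1" for n
  proof -
    have "norm (y n) \<le> norm \<xi> + dist (y n) \<xi>" by (metis add.commute dist_norm norm_triangle_sub)
    also have "dist (y n) \<xi> \<le> 1" using y(1)[of n] by (rule less_imp_le[OF less_le_trans]) auto
    finally show ?thesis by simp
  qed
  have "(\<integral>x. h (x \<bullet> y n) \<partial>M) = (\<integral>x. h (x \<bullet> y n) \<partial>N)" for n
  proof -
    define t where "t = norm (y n)"
    have t: "t > 0" using y(2) by (simp add: t_def)
    have yn: "x \<bullet> y n = t * (x \<bullet> sgn (y n))" for x
      using t by (simp add: t_def sgn_div_norm)
    have "(\<integral>x. h (t * (x \<bullet> sgn (y n))) \<partial>M) = (\<integral>x. h (t * (x \<bullet> sgn (y n))) \<partial>N)"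
    \<comment> \<open>The length \<open>t\<close> of \<open>y n\<close> is absorbed into the
      profile; as \<open>t > 0\<close>, the profile still vanishes on the non-negative
      half-line.\<close>
    proof (rule integral_halfline_eq[OF M N, of "sgn (y n)" "\<lambda>s. h (t * s)"])
      show "integrable M (\<lambda>x. h (t * (x \<bullet> sgn (y n))))" "integrable N (\<lambda>x. h (t * (x \<bullet> sgn (y n))))"
        unfolding yn[symmetric] using ridge_integrable[OF h bd C] by auto
    qed (use y(3) h0 t in auto)
    then show ?thesis by (simp add: yn)
  qed
  moreover have "(\<lambda>n. \<integral>x. h (x \<bullet> y n) \<partial>L) \<longlonglongrightarrow> (\<integral>x. h (x \<bullet> \<xi>) \<partial>L)"
    if sL: "sets L = sets borel" and intL: "integrable L (\<lambda>x. min (norm x ^ k) (norm x ^ Suc k))" for L :: "'a measure"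
  proof (rule integral_dominated_convergence[where w="\<lambda>x. (C * (1 + (norm \<xi> + 1)) ^ Suc k) * min (norm x ^ k) (norm x ^ Suc k)"])
    have [measurable_cong]: "sets L = sets borel" by (rule sL)
    show "(\<lambda>x. h (x \<bullet> \<xi>)) \<in> borel_measurable L" "\<And>n. (\<lambda>x. h (x \<bullet> y n)) \<in> borel_measurable L" by measurable
    show "integrable L (\<lambda>x. (C * (1 + (norm \<xi> + 1)) ^ Suc k) * min (norm x ^ k) (norm x ^ Suc k))"
      using intL by (rule integrable_mult_right)
    show "AE x in L. norm (h (x \<bullet> y n)) \<le> (C * (1 + (norm \<xi> + 1)) ^ Suc k) * min (norm x ^ k) (norm x ^ Suc k)" for n
      by (intro AE_I2 ridge_bound[OF bd C yB])
    show "AE x in L. (\<lambda>n. h (x \<bullet> y n)) \<longlonglongrightarrow> h (x \<bullet> \<xi>)"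
    proof (rule AE_I2)
      fix x :: 'a
      have "isCont h (x \<bullet> \<xi>)" using h by (simp add: continuous_on_eq_continuous_at)
      then show "(\<lambda>n. h (x \<bullet> y n)) \<longlonglongrightarrow> h (x \<bullet> \<xi>)"
        by (rule isCont_tendsto_compose) (intro tendsto_intros ylim)
    qed
  qed
  \<comment> \<open>Here \<open>calculation\<close> is the equality of integrals along
    \<open>y n\<close>, so both integrals at \<xi> are limits of the same sequence.\<close>
  from LIMSEQ_unique[OF this[OF sets_M int_M]] this[OF sets_N int_N] calculation
  have "(\<integral>x. h (x \<bullet> \<xi>) \<partial>M) = (\<integral>x. h (x \<bullet> \<xi>) \<partial>N)" by simp
  then show ?thesis using ridge_integrable[OF h bd C] by (simp add: same_integral_def)
qed

text \<open>A profile vanishing at 0 splits into its parts on the two half-lines; the positive part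
  is a half-ridge in the opposite direction \<open>-\<xi>\<close>.\<close>

lemma same_integral_ridge:
  fixes g :: "real \<Rightarrow> complex"
  assumes g: "continuous_on UNIV g"
    and bd: "\<And>s. norm (g s) \<le> C * min (\<bar>s\<bar> ^ k) (\<bar>s\<bar> ^ Suc k)" and C: "C \<ge> 0"
  shows "same_integral M N (\<lambda>x. g (x \<bullet> \<xi>))"
proof -
  have g0: "g 0 = 0" using bd[of 0] by (cases k) auto
  have nn: "0 \<le> C * min (\<bar>s\<bar> ^ k) (\<bar>s\<bar> ^ Suc k)" for s :: real using C by (auto simp: min_def)
  have cont: "continuous_on UNIV (\<lambda>s. g (min s 0))"  "continuous_on UNIV (\<lambda>s. g (- min s 0))"
    by (intro continuous_on_compose2[OF g] continuous_intros; simp)+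
  have bd': "norm (g (min s 0)) \<le> C * min (\<bar>s\<bar> ^ k) (\<bar>s\<bar> ^ Suc k)"
    "norm (g (- min s 0)) \<le> C * min (\<bar>s\<bar> ^ k) (\<bar>s\<bar> ^ Suc k)" for s
    using bd[of s] bd[of "-s"] nn[of s] g0 by (auto simp: min_def[of s 0] simp del: power_Suc)
  have 1: "same_integral M N (\<lambda>x. g (min (x \<bullet> \<xi>) 0))"
    by (rule same_integral_halfridge[OF cont(1) _ bd'(1) C]) (simp add: g0)
  have 2: "same_integral M N (\<lambda>x. g (- min (x \<bullet> (-\<xi>)) 0))"
    by (rule same_integral_halfridge[OF cont(2) _ bd'(2) C]) (simp add: g0)
  have "g (x \<bullet> \<xi>) = g (min (x \<bullet> \<xi>) 0) + g (- min (x \<bullet> (-\<xi>)) 0)" for x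
    by (auto simp: min_def g0)
  then show ?thesis using same_integral_add[OF 1 2] by presburger
qed

end

section \<open>Trigonometric polynomials and uniqueness\<close>

primrec fdiff :: "nat \<Rightarrow> real \<Rightarrow> (real \<Rightarrow> complex) \<Rightarrow> real \<Rightarrow> complex" where
  "fdiff 0 b f a = f a"
| "fdiff (Suc n) b f a = fdiff n b f (a + b) - fdiff n b f a"

lemma fdiff_diff: "fdiff n b (\<lambda>s. f s - g s) a = fdiff n b f a - fdiff n b g a"
  by (induction n arbitrary: a) auto

lemma fdiff_mult: "fdiff n b (\<lambda>s. c * f s) a = c * fdiff n b f a"
  by (induction n arbitrary: a) (auto simp: algebra_simps)

lemma fdiff_zero: "fdiff n b (\<lambda>s. 0) a = 0"
  by (induction n arbitrary: a) auto

lemma fdiff_add: "fdiff n b (\<lambda>s. f s + g s) a = fdiff n b f a + fdiff n b g a"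
  by (induction n arbitrary: a) auto

lemma fdiff_sum: "finite I \<Longrightarrow> fdiff n b (\<lambda>s. \<Sum>i\<in>I. f i s) a = (\<Sum>i\<in>I. fdiff n b (f i) a)"
  by (induction I rule: finite_induct) (auto simp: fdiff_zero fdiff_add)

text \<open>The recursion takes the new difference last; taking it first instead permits induction
  on the degree of the function.\<close>

lemma fdiff_Suc': "fdiff (Suc n) b f a = fdiff n b (\<lambda>s. f (s + b) - f s) a"
proof (induction n arbitrary: a)
  case (Suc n)
  show ?case using Suc[of a] Suc[of "a + b"] by (simp only: fdiff.simps)
qed simp

text \<open>One difference lowers the degree: by the binomial theorem the top power cancels, and the
  induction hypothesis kills each lower power.\<close>

lemma fdiff_power_eq_0:
  assumes "i < n" shows "fdiff n b (\<lambda>s. of_real s ^ i) a = 0"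
  using assms
proof (induction n arbitrary: i)
  case (Suc n)
  have "of_real (s + b) ^ i - of_real s ^ i
      = (\<Sum>l<i. (of_nat (i choose l) * of_real b ^ (i - l)) * (of_real s ^ l :: complex))" for s
    by (simp add: binomial_ring lessThan_Suc_atMost[symmetric] mult_ac)
  then have "fdiff (Suc n) b (\<lambda>s. of_real s ^ i) a =
      (\<Sum>l<i. (of_nat (i choose l) * of_real b ^ (i - l)) * fdiff n b (\<lambda>s. of_real s ^ l) a)"
    unfolding fdiff_Suc' by (simp only: fdiff_sum fdiff_mult finite_lessThan)
  also have "\<dots> = 0" using Suc by (intro sum.neutral ballI) auto
  finally show ?case .
qed simp

lemma fdiff_iexp: "fdiff n b iexp a = iexp a * (iexp b - 1) ^ n"
  by (induction n arbitrary: a) (auto simp: algebra_simps exp_add)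

definition exp_remainder :: "nat \<Rightarrow> real \<Rightarrow> complex" where
  "exp_remainder k s = iexp s - (\<Sum>j\<le>k. (\<i> * complex_of_real s) ^ j / fact j)"

text \<open>Differences of order above \<open>k\<close> annihilate the Taylor polynomial, while
  \<open>iexp\<close> is an eigenfunction of the difference operator with eigenvalue
  \<open>iexp b - 1\<close>.\<close>

lemma fdiff_exp_remainder:
  assumes "k < n" shows "fdiff n b (exp_remainder k) a = iexp a * (iexp b - 1) ^ n"
proof -
  have "(\<lambda>s. \<Sum>j\<le>k. (\<i> * complex_of_real s) ^ j / fact j) =
    (\<lambda>s. \<Sum>j\<le>k. (\<i> ^ j / fact j) * complex_of_real s ^ j)"
    by (simp add: power_mult_distrib)
  then have "fdiff n b (\<lambda>s. \<Sum>j\<le>k. (\<i> * complex_of_real s) ^ j / fact j) a = 0"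
    using assms by (simp only: fdiff_sum fdiff_mult finite_atMost) (auto intro!: sum.neutral simp: fdiff_power_eq_0)
  then show ?thesis unfolding exp_remainder_def fdiff_diff fdiff_iexp by simp
qed

text \<open>The two standard Taylor estimates, by the next term and by twice the last term, with
  factorials dropped; together they give the growth that both measures integrate.\<close>

lemma norm_exp_remainder_le: "norm (exp_remainder k s) \<le> 2 * min (\<bar>s\<bar> ^ k) (\<bar>s\<bar> ^ Suc k)"
proof -
  have "norm (exp_remainder k s) \<le> \<bar>s\<bar> ^ Suc k / fact (Suc k)"
    unfolding exp_remainder_def using iexp_approx1[of s k] by simp
  also have "\<dots> \<le> \<bar>s\<bar> ^ Suc k / 1"
    by (intro divide_left_mono fact_ge_1) auto
  also have "\<dots> \<le> 2 * \<bar>s\<bar> ^ Suc k" by simp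
  finally have 1: "norm (exp_remainder k s) \<le> 2 * \<bar>s\<bar> ^ Suc k" .
  have "norm (exp_remainder k s) \<le> 2 * \<bar>s\<bar> ^ k / fact k"
    unfolding exp_remainder_def using iexp_approx2[of s k] by simp
  also have "\<dots> \<le> 2 * \<bar>s\<bar> ^ k / 1"
    by (intro divide_left_mono fact_ge_1) auto
  finally show ?thesis using 1 by (simp add: min_def)
qed

text \<open>The factor \<open>iexp (- b)\<close> centres the second difference, whose symbol becomes
  real and of one sign, namely \<open>- 4 * (sin (b / 2))\<^sup>2\<close>. Even orders thus yield a
  non-negative weight up to a global sign.\<close>

lemma iexp_half_angle: "iexp (- b) * (iexp b - 1)\<^sup>2 = - of_real (2 - 2 * cos b)"
proof -
  have 1: "iexp (- b) * iexp b = 1" by (simp flip: exp_add)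
  have 2: "iexp b + iexp (- b) = of_real (2 * cos b)"
    unfolding cis_conv_exp[symmetric] by (simp add: complex_eq_iff)
  have "iexp (- b) * (iexp b - 1)\<^sup>2 = (iexp (- b) * iexp b) * iexp b - 2 * (iexp (- b) * iexp b) + iexp (- b)"
    by (simp add: power2_eq_square algebra_simps)
  also have "\<dots> = (iexp b + iexp (- b)) - 2" unfolding 1 by simp
  finally show ?thesis unfolding 2 by simp
qed

lemma iexp_half_angle_power:
  "iexp (a - real m * b) * (iexp b - 1) ^ (2 * m) = (- 1) ^ m * (iexp a * of_real ((2 - 2 * cos b) ^ m))"
proof -
  have "iexp (a - real m * b) = iexp a * iexp (- b) ^ m"
    by (simp add: exp_diff exp_minus exp_of_nat_mult[symmetric] power_inverse divide_inverse mult_ac right_diff_distrib)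
  then have "iexp (a - real m * b) * (iexp b - 1) ^ (2 * m) = iexp a * (iexp (- b) * (iexp b - 1)\<^sup>2) ^ m"
    by (simp only: power_mult_distrib power_mult mult.assoc)
  also have "\<dots> = iexp a * ((- 1) ^ m * of_real (2 - 2 * cos b) ^ m)"
    unfolding iexp_half_angle by (metis mult_minus1 power_mult_distrib)
  finally show ?thesis by simp
qed

section \<open>Trigonometric polynomials and the weight\<close>

inductive trig_poly :: "('a::euclidean_space \<Rightarrow> real) \<Rightarrow> bool" where
  cos: "trig_poly (\<lambda>x. c * cos (x \<bullet> \<xi> + t))"
| add: "trig_poly f \<Longrightarrow> trig_poly g \<Longrightarrow> trig_poly (\<lambda>x. f x + g x)"

lemma trig_poly_const: "trig_poly (\<lambda>x. c)"
  using trig_poly.cos[of c 0 0] by simp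

lemma trig_poly_sin: "trig_poly (\<lambda>x. c * sin (x \<bullet> \<xi>))"
  using trig_poly.cos[of c \<xi> "- pi / 2"] by (simp add: cos_add cos_diff)

lemma trig_poly_sum: "finite I \<Longrightarrow> (\<And>i. i \<in> I \<Longrightarrow> trig_poly (f i)) \<Longrightarrow> trig_poly (\<lambda>x. \<Sum>i\<in>I. f i x)"
  by (induction I rule: finite_induct) (auto intro: trig_poly_const trig_poly.add)

text \<open>Product-to-sum formula; the free phase in the generators covers sines and keeps the
  products of generators in the class.\<close>

lemma trig_poly_mult:
  assumes "trig_poly f" "trig_poly g" shows "trig_poly (\<lambda>x. f x * g x)"
  using assms(1)
proof induction
  case (cos c \<xi> t)
  show ?case using assms(2)
  proof induction
    case (cos d \<zeta> u)
    have "(\<lambda>x. c * cos (x \<bullet> \<xi> + t) * (d * cos (x \<bullet> \<zeta> + u))) =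
      (\<lambda>x. (c * d / 2) * cos (x \<bullet> (\<xi> - \<zeta>) + (t - u)) + (c * d / 2) * cos (x \<bullet> (\<xi> + \<zeta>) + (t + u)))"
    proof
      fix x
      have e: "x \<bullet> (\<xi> - \<zeta>) + (t - u) = (x \<bullet> \<xi> + t) - (x \<bullet> \<zeta> + u)"
        "x \<bullet> (\<xi> + \<zeta>) + (t + u) = (x \<bullet> \<xi> + t) + (x \<bullet> \<zeta> + u)"
        by (auto simp: inner_diff_right inner_add_right)
      show "c * cos (x \<bullet> \<xi> + t) * (d * cos (x \<bullet> \<zeta> + u)) =
        (c * d / 2) * cos (x \<bullet> (\<xi> - \<zeta>) + (t - u)) + (c * d / 2) * cos (x \<bullet> (\<xi> + \<zeta>) + (t + u))"
        unfolding e by (simp only: cos_add cos_diff) (simp add: algebra_simps)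
    qed
    then show ?case by (simp only:) (intro trig_poly.intros)
  next
    case (add f g)
    then show ?case using trig_poly.add by (fastforce simp: algebra_simps)
  qed
next
  case (add f g)
  then show ?case using trig_poly.add by (fastforce simp: algebra_simps)
qed

text \<open>The range is bounded and \<open>sine_map P\<close> tends to the identity as \<open>P\<close> grows. Hence a Stone--Weierstrass
  approximation of \<open>f\<close> on a ball gives an approximation of \<open>f \<circ> sine_map P\<close> by trigonometric
  polynomials that is uniform on the whole space.\<close>

definition sine_map :: "real \<Rightarrow> 'a::euclidean_space \<Rightarrow> 'a" where
  "sine_map P x = (\<Sum>b\<in>Basis. (P * sin (x \<bullet> b / P)) *\<^sub>R b)"

text \<open>The coordinates of \<open>sine_map P x\<close> are sines, and trigonometric polynomials
  contain the constants and are closed under sums and products.\<close>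

lemma trig_poly_real_polynomial_sine_map:
  fixes p :: "'a::euclidean_space \<Rightarrow> real"
  assumes "real_polynomial_function p" shows "trig_poly (\<lambda>x. p (sine_map P x))"
  using assms
proof induction
  case (linear f)
  then interpret bounded_linear f .
  have "f (sine_map P x) = (\<Sum>b\<in>Basis. (f b * P) * sin (x \<bullet> (b /\<^sub>R P)))" for x
    unfolding sine_map_def sum scaleR by (intro sum.cong) (auto simp: divide_inverse mult_ac)
  then show ?case by (simp only:) (intro trig_poly_sum trig_poly_sin finite_Basis)
qed (auto intro: trig_poly_const trig_poly.add trig_poly_mult)

text \<open>A single frequency would also vanish on a lattice; two incommensurable ones leave only the origin.\<close>

definition sine_weight :: "nat \<Rightarrow> real \<Rightarrow> 'a::euclidean_space \<Rightarrow> real" where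
  "sine_weight m \<theta> x = (\<Sum>b\<in>Basis. (2 - 2 * cos (x \<bullet> b)) ^ m + (2 - 2 * cos (x \<bullet> (\<theta> *\<^sub>R b))) ^ m)"

lemma sine_weight_nonneg: "sine_weight m \<theta> x \<ge> 0"
  unfolding sine_weight_def by (intro sum_nonneg add_nonneg_nonneg zero_le_power) (auto simp: cos_le_one)

text \<open>In a coordinate where \<open>x\<close> does not vanish, both cosines being 1 would make
  \<open>x \<bullet> b\<close> and its multiple by \<theta> integer multiples of
  \<open>2 * pi\<close>, so \<theta> would be a quotient of integers.\<close>

lemma sine_weight_pos:
  assumes "\<theta> \<notin> \<rat>" "x \<noteq> 0"
  shows "sine_weight m \<theta> x > 0"
proof -
  obtain b where b: "b \<in> Basis" "x \<bullet> b \<noteq> 0" using assms(2) by (auto simp: euclidean_eq_iff[of x 0])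
  have nn: "(2 - 2 * cos t) ^ m \<ge> 0" for t :: real by (intro zero_le_power) (auto simp: cos_le_one)
  have pos: "(2 - 2 * cos t) ^ m > 0" if "cos t \<noteq> 1" for t :: real
    using that cos_le_one[of t] by (intro zero_less_power) linarith
  have "cos (x \<bullet> b) \<noteq> 1 \<or> cos (x \<bullet> (\<theta> *\<^sub>R b)) \<noteq> 1"
  proof (rule ccontr)
    assume "\<not> ?thesis"
    then obtain i j :: int where ij: "x \<bullet> b = real_of_int i * 2 * pi" "\<theta> * (x \<bullet> b) = real_of_int j * 2 * pi"
      by (auto simp: cos_one_2pi_int)
    then have "i \<noteq> 0" using b by auto
    moreover have "\<theta> * real_of_int i = real_of_int j" using ij by auto
    ultimately have "\<theta> = of_int j / of_int i" by (simp add: field_simps)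
    then show False using assms(1) by auto
  qed
  then have "(2 - 2 * cos (x \<bullet> b)) ^ m + (2 - 2 * cos (x \<bullet> (\<theta> *\<^sub>R b))) ^ m > 0"
    using pos nn by (metis add_nonneg_pos add_pos_nonneg)
  then show ?thesis unfolding sine_weight_def
    using b(1) nn by (intro sum_pos2[of _ b]) (auto intro!: add_nonneg_nonneg)
qed

lemma continuous_on_sine_weight: "continuous_on A (sine_weight m \<theta>)"
  unfolding sine_weight_def by (intro continuous_intros)

text \<open>Closed sets form an intersection-stable generator, and the indicator of a non-empty
  closed set is a pointwise limit of the continuous functions
  \<open>max 0 (1 - real n * infdist x X)\<close>.\<close>

lemma finite_borel_measure_eqI:
  fixes M N :: "'a::metric_space measure"
  assumes M: "finite_measure M" "sets M = sets borel" and N: "finite_measure N" "sets N = sets borel"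
    and eq: "\<And>f :: 'a \<Rightarrow> real. continuous_on UNIV f \<Longrightarrow> (\<And>x. 0 \<le> f x \<and> f x \<le> 1) \<Longrightarrow>
      integral\<^sup>L M f = integral\<^sup>L N f"
  shows "M = N"
proof (rule measure_eqI_generator_eq[where E="Collect closed" and \<Omega>=UNIV and A="\<lambda>_. UNIV"])
  have sb: "sets borel = sigma_sets UNIV (Collect (closed :: 'a set \<Rightarrow> bool))"
    by (simp add: borel_eq_closed)
  show "sets M = sigma_sets UNIV (Collect closed)" "sets N = sigma_sets UNIV (Collect closed)"
    using M(2) N(2) sb by auto
  show "emeasure M UNIV \<noteq> \<infinity>" 
    using finite_measure.emeasure_finite[OF M(1)] by auto
  show "Int_stable (Collect (closed :: 'a set \<Rightarrow> bool))" by (auto simp: Int_stable_def)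
  fix X :: "'a set" assume X: "X \<in> Collect closed"
  show "emeasure M X = emeasure N X"
  \<comment> \<open>By convention \<open>infdist x {} = 0\<close>, so for the empty set the
    approximating functions would be constantly 1.\<close>
  proof (cases "X = {}")
    case False
    let ?f = "\<lambda>n x. max 0 (1 - real n * infdist x X)"
    have lim: "(\<lambda>n. integral\<^sup>L L (?f n)) \<longlonglongrightarrow> measure L X" if L: "finite_measure L" "sets L = sets borel" for L
    proof -
      interpret L: finite_measure L by (rule L)
      have [measurable_cong]: "sets L = sets borel" by (rule L)
      have XL: "X \<in> sets L" using X L by auto
      have "(\<lambda>n. integral\<^sup>L L (?f n)) \<longlonglongrightarrow> integral\<^sup>L L (indicator X)"
      proof (rule integral_dominated_convergence[where w="\<lambda>_. 1"])
        show "AE x in L. (\<lambda>n. ?f n x) \<longlonglongrightarrow> indicator X x"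
        proof (rule AE_I2)
          fix x
          show "(\<lambda>n. ?f n x) \<longlonglongrightarrow> indicator X x"
          proof (cases "x \<in> X")
            case False
            then have d: "infdist x X > 0"
              using X \<open>X \<noteq> {}\<close> in_closed_iff_infdist_zero[of X x] infdist_nonneg[of x X] by auto
            obtain n0 where "1 / infdist x X < real n0" using reals_Archimedean2 by blast
            then have "?f n x = 0" if "n \<ge> n0" for n
            proof -
              have "1 / infdist x X < real n" using \<open>1 / infdist x X < real n0\<close> that by linarith
              then show ?thesis using d by (simp add: field_simps)
            qed
            then have "eventually (\<lambda>n. ?f n x = 0) sequentially" by (auto simp: eventually_sequentially)
            then show ?thesis using False by (intro tendsto_eventually) auto
          qed simp
        qed
        show "indicator X \<in> borel_measurable L" using XL by simp
        show "?f n \<in> borel_measurable L" for n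
          unfolding measurable_cong_sets[OF L(2) refl]
          by (intro borel_measurable_continuous_onI continuous_intros)
        show "AE x in L. norm (?f n x) \<le> 1" for n
          by (intro AE_I2) (auto simp: infdist_nonneg)
      qed simp
      then show ?thesis using XL by simp
    qed
    have "integral\<^sup>L M (?f n) = integral\<^sup>L N (?f n)" for n
      by (intro eq continuous_intros) (auto simp: infdist_nonneg)
    then have "measure M X = measure N X"
      using LIMSEQ_unique[OF lim[OF M]] lim[OF N] by simp
    then show ?thesis
      using finite_measure.emeasure_eq_measure[OF M(1)] finite_measure.emeasure_eq_measure[OF N(1)] by simp
  qed simp
qed auto

section \<open>From weighted exponentials to equality of the measures\<close>

context halfspace_equal begin

text \<open>With base point \<open>x \<bullet> \<xi>\<close> and step
  \<open>x \<bullet> \<eta>\<close>, a difference in the real variable is a difference in the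
  frequency \<xi>, hence a combination of ridge functions.\<close>

lemma same_integral_fdiff:
  "same_integral M N (\<lambda>x. fdiff n (x \<bullet> \<eta>) (exp_remainder k) (x \<bullet> \<xi>))"
proof (induction n arbitrary: \<xi>)
  case 0
  show ?case unfolding fdiff.simps
    by (rule same_integral_ridge[OF _ norm_exp_remainder_le])
      (auto simp: exp_remainder_def intro!: continuous_intros)
next
  case (Suc n)
  from same_integral_diff[OF Suc[of "\<xi> + \<eta>"] Suc[of \<xi>]] show ?case by (simp add: inner_add_right)
qed

text \<open>The order \<open>2 * Suc k\<close> exceeds \<open>k\<close>, which removes the Taylor
  polynomial, and is even, which makes the factor real. Starting at
  \<open>\<xi> - real (Suc k) *\<^sub>R \<eta>\<close> centres the difference at \<xi>; the sign
  \<open>(-1) ^ Suc k\<close> is cancelled.\<close>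

lemma same_integral_weighted_iexp:
  "same_integral M N (\<lambda>x. iexp (x \<bullet> \<xi>) * of_real ((2 - 2 * cos (x \<bullet> \<eta>)) ^ Suc k))"
proof -
  have "(-1) ^ Suc k * fdiff (2 * Suc k) (x \<bullet> \<eta>) (exp_remainder k) (x \<bullet> (\<xi> - real (Suc k) *\<^sub>R \<eta>))
      = iexp (x \<bullet> \<xi>) * of_real ((2 - 2 * cos (x \<bullet> \<eta>)) ^ Suc k)" for x
  proof -
    have "fdiff (2 * Suc k) (x \<bullet> \<eta>) (exp_remainder k) (x \<bullet> (\<xi> - real (Suc k) *\<^sub>R \<eta>))
      = iexp (x \<bullet> \<xi> - real (Suc k) * (x \<bullet> \<eta>)) * (iexp (x \<bullet> \<eta>) - 1) ^ (2 * Suc k)"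
      by (subst fdiff_exp_remainder) (auto simp: inner_diff_right)
    also have "\<dots> = (- 1) ^ Suc k * (iexp (x \<bullet> \<xi>) * of_real ((2 - 2 * cos (x \<bullet> \<eta>)) ^ Suc k))"
      by (rule iexp_half_angle_power)
    finally show ?thesis by (simp only: mult.assoc[symmetric] power_add[symmetric] power_mult_distrib[symmetric]) simp
  qed
  with same_integral_mult[OF same_integral_fdiff[of "2 * Suc k" \<eta> "\<xi> - real (Suc k) *\<^sub>R \<eta>"], of "(-1) ^ Suc k"]
  show ?thesis by (simp only:)
qed

abbreviation weight :: "real \<Rightarrow> 'a \<Rightarrow> real" where
  "weight \<theta> \<equiv> sine_weight (Suc k) \<theta>"

lemma same_integral_weight_iexp:
  "same_integral M N (\<lambda>x. iexp (x \<bullet> \<xi>) * of_real (weight \<theta> x))"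
proof -
  have "same_integral M N (\<lambda>x. \<Sum>b\<in>Basis. iexp (x \<bullet> \<xi>) * of_real ((2 - 2 * cos (x \<bullet> b)) ^ Suc k)
    + iexp (x \<bullet> \<xi>) * of_real ((2 - 2 * cos (x \<bullet> (\<theta> *\<^sub>R b))) ^ Suc k))"
    by (intro same_integral_sum same_integral_add same_integral_weighted_iexp)
  then show ?thesis
    by (simp only: sine_weight_def of_real_sum of_real_add sum_distrib_left distrib_left)
qed

lemma same_integral_trig_poly:
  assumes "trig_poly f" shows "same_integral M N (\<lambda>x. f x * weight \<theta> x)"
  using assms
proof induction
  case (cos c \<xi> t)
  \<comment> \<open>The complex constant \<open>iexp t\<close> supplies the phase, so complex
    linearity and real parts reach every generator.\<close>
  have "Re (of_real c * iexp t * (iexp (x \<bullet> \<xi>) * of_real (weight \<theta> x))) = c * cos (x \<bullet> \<xi> + t) * weight \<theta> x" for x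
  proof -
    have "of_real c * iexp t * (iexp (x \<bullet> \<xi>) * of_real (weight \<theta> x)) = of_real (c * weight \<theta> x) * iexp (x \<bullet> \<xi> + t)"
      by (simp add: exp_add algebra_simps)
    also have "Re \<dots> = c * weight \<theta> x * cos (x \<bullet> \<xi> + t)"
      by (simp only: cis_conv_exp[symmetric] Re_complex_of_real Im_complex_of_real complex.sel times_complex.sel cis.sel)
    finally show ?thesis by (simp add: mult_ac)
  qed
  with same_integral_Re[OF same_integral_mult[OF same_integral_weight_iexp[of \<xi> \<theta>], of "of_real c * iexp t"]]
  show ?case by simp
next
  case (add f g)
  from same_integral_add[OF add.IH] show ?case by (simp only: distrib_right)
qed

lemma same_integral_weight: "same_integral M N (weight \<theta>)"
  using same_integral_trig_poly[OF trig_poly_const[of 1]] by simp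

text \<open>Stone-Weierstrass approximates \<open>f\<close> only on compact sets. Composition with
  \<open>sine_map P\<close> has bounded range, so the approximation error is uniform and is
  integrated against the finite total weight; then \<open>P\<close> tends to infinity under the
  majorant \<open>B * weight \<theta> x\<close>.\<close>

lemma same_integral_bounded_continuous:
  fixes f :: "'a \<Rightarrow> real"
  assumes f: "continuous_on UNIV f" and bd: "\<And>x. \<bar>f x\<bar> \<le> B"
  shows "same_integral M N (\<lambda>x. f x * weight \<theta> x)"
proof -
  note W0 = sine_weight_nonneg[of "Suc k" \<theta>]
  have Wm[measurable]: "weight \<theta> \<in> borel_measurable borel"
    by (intro borel_measurable_continuous_onI continuous_on_sine_weight)
  have WM: "integrable M (weight \<theta>)" and WN: "integrable N (weight \<theta>)"
    using same_integral_weight by (auto simp: same_integral_def)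
  have int: "integrable L (\<lambda>x. g x * weight \<theta> x)"
    if "sets L = sets borel" "integrable L (weight \<theta>)" "g \<in> borel_measurable borel" "\<And>x. \<bar>g x\<bar> \<le> D" for L g D
  proof (rule Bochner_Integration.integrable_bound)
    show "integrable L (\<lambda>x. D * weight \<theta> x)" using that by auto
    have [measurable_cong]: "sets L = sets borel" by (rule that)
    note that(3)[measurable]
    show "(\<lambda>x. g x * weight \<theta> x) \<in> borel_measurable L" by measurable
    have "norm (g x * weight \<theta> x) \<le> norm (D * weight \<theta> x)" for x
      using W0[of x] that(4)[of x] by (auto simp: abs_mult intro!: mult_right_mono)
    then show "AE x in L. norm (g x * weight \<theta> x) \<le> norm (D * weight \<theta> x)" by simp
  qed
  have smc: "continuous_on UNIV (sine_map P :: 'a \<Rightarrow> 'a)" for P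
    unfolding sine_map_def divide_inverse by (intro continuous_intros)
  have fm[measurable]: "f \<in> borel_measurable borel" "\<And>P. (\<lambda>x. f (sine_map P x)) \<in> borel_measurable borel"
    using f smc by (auto intro!: borel_measurable_continuous_onI continuous_on_compose2[OF f])
  have sine: "(\<integral>x. f (sine_map P x) * weight \<theta> x \<partial>M) = (\<integral>x. f (sine_map P x) * weight \<theta> x \<partial>N)" for P
  proof -
    let ?D = "(\<integral>x. f (sine_map P x) * weight \<theta> x \<partial>M) - (\<integral>x. f (sine_map P x) * weight \<theta> x \<partial>N)"
    let ?K = "integral\<^sup>L M (weight \<theta>) + integral\<^sup>L N (weight \<theta>)"
    have K: "?K \<ge> 0" using W0 by (intro add_nonneg_nonneg Bochner_Integration.integral_nonneg) auto
    have "\<bar>?D\<bar> \<le> e * ?K" if e: "e > 0" for e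
    proof -
      \<comment> \<open>This ball contains the range of \<open>sine_map P\<close>, as each of its
        coordinates is bounded by the absolute value of \<open>P\<close>.\<close>
      have "compact (cball (0::'a) (real DIM('a) * \<bar>P\<bar>))" by simp
      moreover have "continuous_on (cball (0::'a) (real DIM('a) * \<bar>P\<bar>)) f" using f by (rule continuous_on_subset) auto
      ultimately obtain p where p: "real_polynomial_function p" 
        "\<And>x. x \<in> cball (0::'a) (real DIM('a) * \<bar>P\<bar>) \<Longrightarrow> \<bar>f x - p x\<bar> < e"
        using Stone_Weierstrass_real_polynomial_function[OF _ _ e] by metis
      have "norm (sine_map P x) \<le> real DIM('a) * \<bar>P\<bar>" for x :: 'a
        unfolding sine_map_def
        by (rule order_trans[OF norm_sum sum_bounded_above])
          (auto simp: abs_mult intro!: mult_left_le)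
      then have close: "\<bar>f (sine_map P x) - p (sine_map P x)\<bar> \<le> e" for x
        using p(2)[of "sine_map P x"] by (simp add: less_imp_le)
      have same: "same_integral M N (\<lambda>x. p (sine_map P x) * weight \<theta> x)"
        by (intro same_integral_trig_poly trig_poly_real_polynomial_sine_map p)
      have est: "\<bar>(\<integral>x. f (sine_map P x) * weight \<theta> x \<partial>L) - (\<integral>x. p (sine_map P x) * weight \<theta> x \<partial>L)\<bar>
          \<le> e * integral\<^sup>L L (weight \<theta>)"
        if L: "sets L = sets borel" "integrable L (weight \<theta>)" "integrable L (\<lambda>x. p (sine_map P x) * weight \<theta> x)" for L
      proof -
        note i = int[OF L(1,2) fm(2) bd]
        have "(\<integral>x. f (sine_map P x) * weight \<theta> x \<partial>L) - (\<integral>x. p (sine_map P x) * weight \<theta> x \<partial>L)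
          = (\<integral>x. f (sine_map P x) * weight \<theta> x - p (sine_map P x) * weight \<theta> x \<partial>L)"
          using i L by simp
        also have "norm \<dots> \<le> (\<integral>x. e * weight \<theta> x \<partial>L)"
        proof (rule Bochner_Integration.integral_norm_bound_integral)
          show "integrable L (\<lambda>x. f (sine_map P x) * weight \<theta> x - p (sine_map P x) * weight \<theta> x)" using i L by simp
          show "integrable L (\<lambda>x. e * weight \<theta> x)" using L by simp
          fix x
          have "norm (f (sine_map P x) * weight \<theta> x - p (sine_map P x) * weight \<theta> x) = 
              \<bar>f (sine_map P x) - p (sine_map P x)\<bar> * weight \<theta> x"
            using W0[of x] by (simp add: left_diff_distrib[symmetric] abs_mult)
          also have "\<dots> \<le> e * weight \<theta> x" using close W0 by (intro mult_right_mono) auto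
          finally show "norm (f (sine_map P x) * weight \<theta> x - p (sine_map P x) * weight \<theta> x) \<le> e * weight \<theta> x" .
        qed
        finally show ?thesis by simp
      qed
      have "integrable M (\<lambda>x. p (sine_map P x) * weight \<theta> x)" "integrable N (\<lambda>x. p (sine_map P x) * weight \<theta> x)"
        "(\<integral>x. p (sine_map P x) * weight \<theta> x \<partial>M) = (\<integral>x. p (sine_map P x) * weight \<theta> x \<partial>N)"
        using same by (auto simp: same_integral_def)
      with est[OF sets_M WM] est[OF sets_N WN] show ?thesis
        unfolding distrib_left by linarith
    qed
    then have "\<bar>?D\<bar> \<le> 0 + e" if "e > 0" for e
    proof -
      \<comment> \<open>Adding 1 keeps the denominator positive when the total weight
        \<open>?K\<close> is 0.\<close>
      have "\<bar>?D\<bar> \<le> e / (?K + 1) * ?K" using \<open>\<And>e. e > 0 \<Longrightarrow> \<bar>?D\<bar> \<le> e * ?K\<close>[of "e / (?K + 1)"] that K by simp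
      also have "\<dots> \<le> e" using that K by (simp add: field_simps)
      finally show ?thesis by simp
    qed
    then have "\<bar>?D\<bar> \<le> 0" by (rule field_le_epsilon)
    then show ?thesis by simp
  qed
  have smlim: "(\<lambda>n. sine_map (real (Suc n)) x) \<longlonglongrightarrow> x" for x :: 'a
  proof -
    have s: "(\<lambda>n. real (Suc n) * sin (t / real (Suc n))) \<longlonglongrightarrow> t" for t
    proof -
      have "((\<lambda>y. y * sin (t / y)) \<longlongrightarrow> t) at_top" by real_asymp
      moreover have "filterlim (\<lambda>n. real (Suc n)) at_top sequentially"
        by (intro filterlim_compose[OF filterlim_real_sequentially filterlim_Suc])
      ultimately show ?thesis by (rule filterlim_compose)
    qed
    have "(\<lambda>n. sine_map (real (Suc n)) x) \<longlonglongrightarrow> (\<Sum>b\<in>Basis. (x \<bullet> b) *\<^sub>R b)"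
      unfolding sine_map_def by (intro tendsto_intros s)
    then show ?thesis by (simp add: euclidean_representation)
  qed
  have lim: "(\<lambda>n. \<integral>x. f (sine_map (real (Suc n)) x) * weight \<theta> x \<partial>L) \<longlonglongrightarrow> (\<integral>x. f x * weight \<theta> x \<partial>L)"
    if L: "sets L = sets borel" "integrable L (weight \<theta>)" for L
  proof (rule integral_dominated_convergence[where w="\<lambda>x. B * weight \<theta> x"])
    have [measurable_cong]: "sets L = sets borel" by (rule L)
    show "(\<lambda>x. f x * weight \<theta> x) \<in> borel_measurable L" 
      "\<And>n. (\<lambda>x. f (sine_map (real (Suc n)) x) * weight \<theta> x) \<in> borel_measurable L"
      by measurable
    show "integrable L (\<lambda>x. B * weight \<theta> x)" using L by simp
    show "AE x in L. norm (f (sine_map (real (Suc n)) x) * weight \<theta> x) \<le> B * weight \<theta> x" for n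
      using bd W0 by (intro AE_I2) (auto simp: abs_mult abs_of_nonneg[OF W0] intro!: mult_right_mono)
    show "AE x in L. (\<lambda>n. f (sine_map (real (Suc n)) x) * weight \<theta> x) \<longlonglongrightarrow> f x * weight \<theta> x"
    proof (rule AE_I2)
      fix x
      have "isCont f x" using f by (simp add: continuous_on_eq_continuous_at)
      then have "(\<lambda>n. f (sine_map (real (Suc n)) x)) \<longlonglongrightarrow> f x" using smlim by (rule isCont_tendsto_compose)
      then show "(\<lambda>n. f (sine_map (real (Suc n)) x) * weight \<theta> x) \<longlonglongrightarrow> f x * weight \<theta> x"
        by (intro tendsto_intros)
    qed
  qed
  have "(\<integral>x. f x * weight \<theta> x \<partial>M) = (\<integral>x. f x * weight \<theta> x \<partial>N)"
    using LIMSEQ_unique[OF lim[OF sets_M WM]] lim[OF sets_N WN] sine by simp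
  then show ?thesis
    using int[OF sets_M WM fm(1) bd] int[OF sets_N WN fm(1) bd] by (simp add: same_integral_def)
qed

text \<open>The weighted measures are finite and integrate bounded continuous functions equally, so
  they coincide. Dividing by the weight recovers \<open>M\<close> and \<open>N\<close>.\<close>

theorem measures_equal: "M = N"
proof -
  obtain \<theta> :: real where th: "\<theta> \<notin> \<rat>"
    using uncountable_UNIV_real countable_rat by (metis UNIV_eq_I)
  have Wm[measurable]: "weight \<theta> \<in> borel_measurable borel"
    by (intro borel_measurable_continuous_onI continuous_on_sine_weight)
  note W0 = sine_weight_nonneg[of "Suc k" \<theta>]
  have WM: "integrable M (weight \<theta>)" and WN: "integrable N (weight \<theta>)"
    using same_integral_weight by (auto simp: same_integral_def)
  let ?d = "\<lambda>L. density L (\<lambda>x. ennreal (weight \<theta> x))"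
  have fin: "finite_measure (?d L)" if "sets L = sets borel" "integrable L (weight \<theta>)" for L
  proof (rule finite_measureI)
    have [measurable_cong]: "sets L = sets borel" by (rule that)
    have "emeasure (?d L) (space (?d L)) = (\<integral>\<^sup>+x. ennreal (weight \<theta> x) \<partial>L)"
      by (subst emeasure_density) (auto intro!: nn_integral_cong)
    also have "\<dots> \<noteq> \<infinity>" using that W0 by (subst nn_integral_eq_integral) auto
    finally show "emeasure (?d L) (space (?d L)) \<noteq> \<infinity>" .
  qed
  have "?d M = ?d N"
  proof (rule finite_borel_measure_eqI)
    fix f :: "'a \<Rightarrow> real" assume f: "continuous_on UNIV f" "\<And>x. 0 \<le> f x \<and> f x \<le> 1"
    have [measurable]: "f \<in> borel_measurable borel" using f by (intro borel_measurable_continuous_onI)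
    have "same_integral M N (\<lambda>x. f x * weight \<theta> x)"
      by (rule same_integral_bounded_continuous[where B=1]) (use f in auto)
    moreover have "integral\<^sup>L (?d L) f = (\<integral>x. f x * weight \<theta> x \<partial>L)" if "sets L = sets borel" for L
    proof -
      have [measurable_cong]: "sets L = sets borel" by (rule that)
      have "integral\<^sup>L (?d L) f = (\<integral>x. weight \<theta> x *\<^sub>R f x \<partial>L)"
        by (rule integral_density) (use W0 in auto)
      then show ?thesis by (simp add: mult.commute)
    qed
    ultimately show "integral\<^sup>L (?d M) f = integral\<^sup>L (?d N) f"
      using sets_M sets_N by (simp add: same_integral_def)
  qed (use fin sets_M sets_N WM WN in auto)
  moreover have "density (?d L) (\<lambda>x. ennreal (1 / weight \<theta> x)) = L" if "admissible_measure L" for L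
  proof -
    have sL[measurable_cong]: "sets L = sets borel" using that by (rule admissible_measure_sets)
    \<comment> \<open>The weight vanishes at the origin, so the density can be inverted there only
      because an admissible measure has no mass at 0.\<close>
    have "AE x in L. x \<noteq> 0"
      using that by (intro AE_I[of _ _ "{0}"]) (auto simp: admissible_measure_def)
    then have ae: "AE x in L. ennreal (weight \<theta> x) * ennreal (1 / weight \<theta> x) = 1"
    proof eventually_elim
      case (elim x)
      then have "weight \<theta> x > 0" by (rule sine_weight_pos[OF th])
      then show ?case by (simp add: ennreal_mult'[symmetric])
    qed
    have "density (?d L) (\<lambda>x. ennreal (1 / weight \<theta> x)) = density L (\<lambda>x. ennreal (weight \<theta> x) * ennreal (1 / weight \<theta> x))"
      by (rule density_density_eq) measurable
    also have "\<dots> = density L (\<lambda>_. 1)" using ae by (intro density_cong) auto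
    finally show ?thesis by (simp add: density_1)
  qed
  ultimately show ?thesis using M N by metis
qed

end

text \<open>Taking \<open>k\<close> as the integer part of \<beta>, non-integrality makes both
  inequalities \<open>real k < \<beta>\<close> and \<open>\<beta> < real (Suc k)\<close> strict, and
  the tail bounds supply the integrability. The common profile \<open>A\<close> makes the half-space
  masses agree.\<close>

lemma admissible_measure_unique:
  fixes M N :: "'a::euclidean_space measure"
  assumes M: "admissible_measure M" and N: "admissible_measure N"
    and AM: "AE \<omega> in sphere_measure. \<forall>p<0. measure M (halfspace \<omega> p) = (-p) powr (-\<beta>) * A \<omega>"
    and AN: "AE \<omega> in sphere_measure. \<forall>p<0. measure N (halfspace \<omega> p) = (-p) powr (-\<beta>) * A \<omega>"
    and beta: "\<beta> > 0" "\<beta> \<notin> \<int>"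
  shows "M = N"
proof -
  define k where "k = nat \<lfloor>\<beta>\<rfloor>"
  have k: "real k = of_int \<lfloor>\<beta>\<rfloor>" using beta by (simp add: k_def)
  have "of_int \<lfloor>\<beta>\<rfloor> \<noteq> \<beta>" using beta(2) by (metis Ints_of_int)
  then have k': "real k < \<beta>" "\<beta> < real (Suc k)" using k by linarith+
  obtain C where C: "C \<ge> 0" "\<And>r. r > 0 \<Longrightarrow> emeasure M {x. r \<le> norm x} \<le> ennreal (C * r powr (-\<beta>))"
    by (rule admissible_tail_bound[OF M AM]) (rule that)
  obtain D where D: "D \<ge> 0" "\<And>r. r > 0 \<Longrightarrow> emeasure N {x. r \<le> norm x} \<le> ennreal (D * r powr (-\<beta>))"
    by (rule admissible_tail_bound[OF N AN]) (rule that)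
  interpret halfspace_equal M N k
  proof
    show "AE \<omega> in sphere_measure. \<forall>p<0. measure M (halfspace \<omega> p) = measure N (halfspace \<omega> p)"
      using AM AN by eventually_elim simp
    show "integrable M (\<lambda>x. min (norm x ^ k) (norm x ^ Suc k))"
      using integrable_min_power_norm[OF admissible_measure_sets[OF M] C k'] .
    show "integrable N (\<lambda>x. min (norm x ^ k) (norm x ^ Suc k))"
      using integrable_min_power_norm[OF admissible_measure_sets[OF N] D k'] .
  qed (rule M N)+
  show ?thesis by (rule measures_equal)
qed

text \<open>Rescaling space by \<open>c\<close> and mass by \<open>c powr \<beta>\<close> preserves
  the half-space masses, so uniqueness makes \<open>M\<close> invariant under it; integrating \<phi>
  turns this invariance into homogeneity.\<close>

lemma homogeneous_measure_if_halfspaces_homogeneous: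
  fixes M :: "'a::euclidean_space measure"
  assumes M: "admissible_measure M"
    and AM: "AE \<omega> in sphere_measure. \<forall>p<0. measure M (halfspace \<omega> p) = (-p) powr (-\<beta>) * A \<omega>"
    and beta: "\<beta> > 0" "\<beta> \<notin> \<int>"
  shows "homogeneous_measure M (- real DIM('a) - \<beta>)"
  unfolding homogeneous_measure_def
proof (intro allI impI)
  fix \<phi> :: "'a \<Rightarrow> real" and c :: real
  assume c: "c > 0" and phi: "smooth_fun \<phi> \<and> compact (closure {x. \<phi> x \<noteq> 0}) \<and> 0 \<notin> closure {x. \<phi> x \<noteq> 0}"
  have [measurable_cong]: "sets M = sets borel" using M by (rule admissible_measure_sets)
  have spM: "space M = UNIV" using sets_eq_imp_space_eq[OF admissible_measure_sets[OF M]] by simp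
  \<comment> \<open>The factor \<open>c powr \<beta>\<close> compensates for the half-space at level
    \<open>p\<close> being pulled back to level \<open>c * p\<close>.\<close>
  define N where "N = density (distr M borel (\<lambda>x. x /\<^sub>R c)) (\<lambda>_. ennreal (c powr \<beta>))"
  have N: "emeasure N B = ennreal (c powr \<beta>) * emeasure M {x. x /\<^sub>R c \<in> B}" if "B \<in> sets borel" for B
  proof -
    have "emeasure N B = ennreal (c powr \<beta>) * emeasure (distr M borel (\<lambda>x. x /\<^sub>R c)) B"
      unfolding N_def using that by (simp add: emeasure_density nn_integral_cmult_indicator)
    also have "emeasure (distr M borel (\<lambda>x. x /\<^sub>R c)) B = emeasure M {x. x /\<^sub>R c \<in> B}"
      using that by (subst emeasure_distr) (auto simp: spM vimage_def)
    finally show ?thesis .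
  qed
  have "admissible_measure N"
    unfolding admissible_measure_def
  proof (intro conjI allI impI)
    show "sets N = sets borel" by (simp add: N_def)
    have "{x::'a. x /\<^sub>R c \<in> {0}} = {0}" using c by auto
    then show "emeasure N {0} = 0" using M N[of "{0}"] by (simp add: admissible_measure_def)
    fix r :: real assume r: "r > 0"
    have "emeasure M {x. x /\<^sub>R c \<in> {x. r \<le> norm x}} < \<infinity>"
      by (rule admissible_finite[OF M, of "r * c"]) (use r c in \<open>auto simp: field_simps\<close>)
    moreover have "emeasure N {x. r \<le> norm x} = ennreal (c powr \<beta>) * emeasure M {x. x /\<^sub>R c \<in> {x. r \<le> norm x}}"
      by (rule N) simp
    ultimately show "emeasure N {x. r \<le> norm x} < \<infinity>"
      by (auto simp: ennreal_mult_less_top)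
  qed
  moreover have "AE \<omega> in sphere_measure. \<forall>p<0. measure N (halfspace \<omega> p) = (-p) powr (-\<beta>) * A \<omega>"
    using AM
  proof (rule eventually_mono, intro allI impI)
    fix \<omega> and p :: real assume *: "\<forall>p<0. measure M (halfspace \<omega> p) = (- p) powr - \<beta> * A \<omega>" and p: "p < 0"
    have "{x. x /\<^sub>R c \<in> halfspace \<omega> p} = halfspace \<omega> (c * p)"
      using c by (auto simp: halfspace_def field_simps)
    then have "measure N (halfspace \<omega> p) = c powr \<beta> * measure M (halfspace \<omega> (c * p))"
      using N[OF halfspace_sets, of \<omega> p] by (simp add: measure_def enn2real_mult)
    also have "\<dots> = c powr \<beta> * ((c * (-p)) powr (-\<beta>) * A \<omega>)"
      using * p c by (simp add: mult_pos_neg)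
    also have "\<dots> = (-p) powr (-\<beta>) * A \<omega>"
      using p c by (subst powr_mult) (auto simp: powr_minus field_simps)
    finally show "measure N (halfspace \<omega> p) = (-p) powr (-\<beta>) * A \<omega>" .
  qed
  ultimately have "M = N" using admissible_measure_unique[OF M _ AM _ beta] by blast
  have "Ck_fun 0 \<phi>" using phi unfolding smooth_fun_def by blast
  then have [measurable]: "\<phi> \<in> borel_measurable borel" by (intro borel_measurable_continuous_onI) simp
  have "integral\<^sup>L M \<phi> = integral\<^sup>L N \<phi>" using \<open>M = N\<close> by simp
  also have "\<dots> = c powr \<beta> * (\<integral>x. \<phi> (x /\<^sub>R c) \<partial>M)"
    unfolding N_def by (subst integral_density) (auto simp: integral_distr)
  finally show "(\<integral>x. \<phi> (x /\<^sub>R c) \<partial>M) = c powr (real DIM('a) + (- real DIM('a) - \<beta>)) * (\<integral>x. \<phi> x \<partial>M)"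
    using c by (simp add: powr_minus field_simps)
qed

section \<open>The Radon transform\<close>

text \<open>Sets that agree almost everywhere with a measurable set are measurable in the
  completion. This makes \<open>a\<close> times a derivative measurable although \<open>a\<close> is
  known only almost everywhere.\<close>

lemma borel_measurable_completion_AE:
  fixes f g :: "'a \<Rightarrow> 'b::topological_space"
  assumes f: "f \<in> borel_measurable (completion M)" and ae: "AE x in completion M. f x = g x"
  shows "g \<in> borel_measurable (completion M)"
proof (rule measurableI)
  fix S :: "'b set" assume "S \<in> sets borel"
  then have "f -` S \<inter> space (completion M) \<in> sets (completion M)" using f by (rule measurable_sets[rotated])
  moreover have ae': "AE x in completion M. x \<in> f -` S \<inter> space (completion M) \<longleftrightarrow> x \<in> g -` S \<inter> space (completion M)"
    using ae by eventually_elim auto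
  ultimately show "g -` S \<inter> space (completion M) \<in> sets (completion M)"
    by (intro completion.in_sets_AE[OF ae']) auto
qed simp

text \<open>Extracts a continuous derivative in \<open>p\<close> and, by compactness of the support
  inside \<open>p < 0\<close>, an interval away from 0 that carries the function and its derivative.
  The support is controlled only for unit vectors \<omega>.\<close>

lemma halfspace_test_fun_partial:
  fixes \<psi> :: "'a::euclidean_space \<times> real \<Rightarrow> real"
  assumes "halfspace_test_fun \<psi>"
  obtains D :: "'a \<times> real \<Rightarrow> real" and e R :: real where "continuous_on UNIV D"
    "\<And>\<omega> p. ((\<lambda>q. \<psi> (\<omega>, q)) has_real_derivative D (\<omega>, p)) (at p)"
    "e > 0" "R > 0"
    "\<And>\<omega> p. norm \<omega> = 1 \<Longrightarrow> p \<notin> {-R..-e} \<Longrightarrow> \<psi> (\<omega>, p) = 0 \<and> D (\<omega>, p) = 0"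
proof -
  define K where "K = closure {z \<in> sphere 0 1 \<times> UNIV. \<psi> z \<noteq> 0}"
  define D where "D = (\<lambda>z. frechet_derivative \<psi> (at z) (0, 1))"
  have K: "compact K" "K \<subseteq> sphere 0 1 \<times> {..<0}"
    using assms by (simp_all add: halfspace_test_fun_def K_def)
  have "\<forall>k. Ck_fun k \<psi>" using assms by (simp add: halfspace_test_fun_def smooth_fun_def)
  then have "Ck_fun (Suc 0) \<psi>" by (rule spec)
  then have diff: "\<And>z. \<psi> differentiable (at z)"
    and cont: "\<And>b. b \<in> Basis \<Longrightarrow> continuous_on UNIV (\<lambda>z. frechet_derivative \<psi> (at z) b)"
    unfolding Ck_fun.simps by blast+
  have D: "continuous_on UNIV D" unfolding D_def by (rule cont) (simp add: Basis_prod_def)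
  have der: "((\<lambda>q. \<psi> (\<omega>, q)) has_real_derivative D (\<omega>, p)) (at p)" for \<omega> p
  proof -
    have 1: "(\<psi> has_derivative frechet_derivative \<psi> (at (\<omega>, p))) (at (\<omega>, p))"
      using diff unfolding frechet_derivative_works .
    have 2: "((\<lambda>q. (\<omega>, q)) has_derivative (\<lambda>h. (0, h))) (at p)"
      by (rule has_derivative_Pair[OF has_derivative_const has_derivative_ident])
    have "((\<lambda>q. \<psi> (\<omega>, q)) has_derivative (\<lambda>h. frechet_derivative \<psi> (at (\<omega>, p)) (0, h))) (at p)"
      by (rule has_derivative_compose[OF 2 1])
    moreover have "frechet_derivative \<psi> (at (\<omega>, p)) (0, h) = D (\<omega>, p) * h" for h
    proof -
      have "frechet_derivative \<psi> (at (\<omega>, p)) (h *\<^sub>R (0, 1)) = h *\<^sub>R D (\<omega>, p)"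
        unfolding D_def by (rule linear_cmul[OF linear_frechet_derivative[OF diff]])
      then show ?thesis by (simp add: mult.commute)
    qed
    ultimately show ?thesis by (simp add: has_field_derivative_def)
  qed
  obtain e R where eR: "e > 0" "R > 0" "\<And>z. z \<in> K \<Longrightarrow> snd z \<in> {-R..-e}"
  \<comment> \<open>An empty support has no extreme levels, so any interval will do; otherwise the
    largest and smallest levels give \<open>e\<close> and \<open>R\<close>.\<close>
  proof (cases "K = {}")
    case True
    then show ?thesis using that[of 1 1] by auto
  next
    case False
    have sK: "compact (snd ` K)" "snd ` K \<noteq> {}" using K False by (auto intro!: compact_continuous_image continuous_intros)
    obtain s where s: "s \<in> snd ` K" "\<And>t. t \<in> snd ` K \<Longrightarrow> t \<le> s" using compact_attains_sup[OF sK] by blast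
    obtain l where l: "l \<in> snd ` K" "\<And>t. t \<in> snd ` K \<Longrightarrow> l \<le> t" using compact_attains_inf[OF sK] by blast
    show ?thesis by (rule that[of "- s" "- l"]) (use s l K(2) in force)+
  qed
  have psi0: "\<psi> (\<omega>, p) = 0" if "norm \<omega> = 1" "p \<notin> {-R..-e}" for \<omega> p
  proof (rule ccontr)
    assume "\<psi> (\<omega>, p) \<noteq> 0"
    then have "(\<omega>, p) \<in> K" unfolding K_def using that closure_subset by fastforce
    then show False using eR(3) that by force
  qed
  have D0: "D (\<omega>, p) = 0" if w: "norm \<omega> = 1" and p: "p \<notin> {-R..-e}" for \<omega> p
  proof -
    \<comment> \<open>Off the interval the function vanishes on an open set of levels, so its
      derivative vanishes too.\<close>
    have "open (- {-R..-e})" by (intro open_Compl closed_atLeastAtMost)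
    with DERIV_const have "((\<lambda>q. \<psi> (\<omega>, q)) has_real_derivative 0) (at p)"
      by (rule has_field_derivative_transform_within_open) (use p psi0[OF w] in auto)
    then show ?thesis using DERIV_unique[OF der] by blast
  qed
  show ?thesis by (rule that[OF D der eR(1,2)]) (use psi0 D0 in auto)
qed

lemma measurable_sphere_measure_borel: "(\<lambda>\<omega>. \<omega>) \<in> measurable (sphere_measure :: 'a::euclidean_space measure) borel"
  unfolding measurable_cong_sets[OF sets_sphere_measure refl] by (rule measurable_restrict_space1) simp

text \<open>Transfers Borel measurability on the whole product to the parameter space, whose factors
  carry restricted sigma-algebras.\<close>

lemma measurable_halfspace_params_borel:
  "(\<lambda>z. z) \<in> measurable (halfspace_params_measure :: ('a::euclidean_space \<times> real) measure) borel"
proof -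
  have "(\<lambda>z. (fst z, snd z)) \<in> measurable (halfspace_params_measure :: ('a \<times> real) measure) (borel \<Otimes>\<^sub>M borel)"
    unfolding halfspace_params_measure_def
  proof (rule measurable_Pair)
    show "fst \<in> measurable (sphere_measure \<Otimes>\<^sub>M restrict_space lborel {..<0::real}) (borel :: 'a measure)"
      by (rule measurable_compose[OF measurable_fst measurable_sphere_measure_borel])
    show "snd \<in> measurable (sphere_measure \<Otimes>\<^sub>M restrict_space lborel {..<0::real}) borel"
      by (rule measurable_compose[OF measurable_snd]) (auto intro!: measurable_restrict_space1)
  qed
  then show ?thesis by (simp add: borel_prod)
qed

lemma space_halfspace_params: 
  "space (halfspace_params_measure :: ('a::euclidean_space \<times> real) measure) = sphere 0 1 \<times> {..<0}"
  by (simp add: halfspace_params_measure_def space_pair_measure space_sphere_measure space_restrict_space)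

lemma sigma_finite_negative_reals: "sigma_finite_measure (restrict_space lborel {..<0::real})"
  by (intro sigma_finite_measure_restrict_space) (auto intro: lborel.sigma_finite_measure_axioms)

text \<open>The null set \<open>{0}\<close> and the tails at radii tending to 0 exhaust the space;
  this is what Fubini requires of \<open>M\<close>.\<close>

lemma sigma_finite_admissible:
  fixes M :: "'a::euclidean_space measure"
  assumes M: "admissible_measure M" shows "sigma_finite_measure M"
proof
  define T where "T = (\<lambda>n::nat. {x::'a. 1 / real (Suc n) \<le> norm x})"
  have sM: "sets M = sets borel" using M by (rule admissible_measure_sets)
  have "x \<in> \<Union>(insert {0} (range T))" for x :: 'a
  proof (cases "x = 0")
    case False
    then obtain n where "inverse (real (Suc n)) < norm x" using reals_Archimedean[of "norm x"] by auto
    then have "x \<in> T n" by (simp add: T_def divide_inverse)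
    then show ?thesis by (intro UnionI[OF insertI2[OF rangeI]])
  qed simp
  then have "UNIV = \<Union>(insert {0} (range T))" by (rule UNIV_eq_I)
  then have U: "\<Union>(insert {0} (range T)) = space M" using sets_eq_imp_space_eq[OF sM] by simp
  have "T n \<in> sets M" for n by (simp add: T_def sM)
  then have S: "insert {0} (range T) \<subseteq> sets M" by (auto simp: sM)
  have "emeasure M (T n) \<noteq> \<infinity>" for n
    using admissible_finite[OF M, of "1 / real (Suc n)" "T n"] by (simp add: T_def less_top)
  then have fin: "\<forall>B\<in>insert {0} (range T). emeasure M B \<noteq> \<infinity>"
    using M by (simp add: admissible_measure_def)
  show "\<exists>A. countable A \<and> A \<subseteq> sets M \<and> \<Union>A = space M \<and> (\<forall>a\<in>A. emeasure M a \<noteq> \<infinity>)"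
    by (intro exI[of _ "insert {0} (range T)"] conjI U S fin) simp
qed

text \<open>As a function of \<open>p\<close> the indicator is a step at
  \<open>x \<bullet> \<omega>\<close>, so the integral runs from there to 0, where the test function
  vanishes. For \<open>x \<bullet> \<omega> \<ge> 0\<close> both sides are 0.\<close>

lemma integral_partial_test_fun:
  fixes \<psi> :: "'a::euclidean_space \<times> real \<Rightarrow> real"
  assumes D: "continuous_on UNIV D"
    and der: "\<And>\<omega> p. ((\<lambda>q. \<psi> (\<omega>, q)) has_real_derivative D (\<omega>, p)) (at p)"
    and e: "e > 0" and w: "norm \<omega> = 1"
    and supp: "\<And>\<omega> p. norm \<omega> = 1 \<Longrightarrow> p \<notin> {-R..-e} \<Longrightarrow> \<psi> (\<omega>, p) = 0 \<and> D (\<omega>, p) = 0"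
  shows "(\<integral>p. indicator (halfspace \<omega> p) x * D (\<omega>, p) \<partial>restrict_space lborel {..<0}) = - \<psi> (\<omega>, x \<bullet> \<omega>)"
proof -
  define s where "s = x \<bullet> \<omega>"
  have Dc: "continuous_on A (\<lambda>p. D (\<omega>, p))" for A
    by (rule continuous_on_compose2[OF D]) (auto intro!: continuous_intros)
  have [measurable]: "(\<lambda>p. D (\<omega>, p)) \<in> borel_measurable borel"
    using Dc by (rule borel_measurable_continuous_onI)
  have "(\<integral>p. indicator (halfspace \<omega> p) x * D (\<omega>, p) \<partial>restrict_space lborel {..<0})
      = (\<integral>p. indicator {..<0} p *\<^sub>R (indicator (halfspace \<omega> p) x * D (\<omega>, p)) \<partial>lborel)"
    by (rule integral_restrict_space) simp
  also have "\<dots> = (\<integral>p. indicator {s<..<0} p *\<^sub>R D (\<omega>, p) \<partial>lborel)"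
    by (intro Bochner_Integration.integral_cong) (auto simp: indicator_def halfspace_def s_def)
  also have "\<dots> = - \<psi> (\<omega>, s)"
  proof (cases "s < 0")
    case True
    \<comment> \<open>The fundamental theorem wants a closed interval: the endpoint \<open>s\<close>
      is a null set and at 0 the derivative is 0.\<close>
    have "AE p in lborel. p \<noteq> s" by (rule AE_lborel_singleton)
    then have "AE p in lborel. indicator {s<..<0} p *\<^sub>R D (\<omega>, p) = indicator {s..0} p *\<^sub>R D (\<omega>, p)"
    proof eventually_elim
      case (elim p)
      have "p = 0 \<Longrightarrow> D (\<omega>, p) = 0" using supp[OF w, of p] e by auto
      then show ?case using elim by (auto simp: indicator_def)
    qed
    then have "(\<integral>p. indicator {s<..<0} p *\<^sub>R D (\<omega>, p) \<partial>lborel) = (\<integral>p. indicator {s..0} p *\<^sub>R D (\<omega>, p) \<partial>lborel)"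
      by (intro integral_cong_AE) auto
    also have "\<dots> = \<psi> (\<omega>, 0) - \<psi> (\<omega>, s)"
      using True Dc by (intro integral_FTC_Icc) 
        (auto intro!: has_field_derivative_at_within[OF der] simp: has_real_derivative_iff_has_vector_derivative[symmetric])
    also have "\<psi> (\<omega>, 0) = 0" using supp[OF w, of 0] e by auto
    finally show ?thesis by simp
  next
    case False
    then have "\<psi> (\<omega>, s) = 0" using supp[OF w, of s] e by auto
    moreover have "{s<..<0} = {}" using False by auto
    ultimately show ?thesis by simp
  qed
  finally show ?thesis by (simp add: s_def)
qed

text \<open>Both sides are iterated integrals of \<open>F z x\<close>, the half-space indicator
  times \<open>D z\<close>. Integrating over \<open>x\<close> first gives \<open>a z * D z\<close>
  almost everywhere; integrating over \<open>z\<close> first gives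
  \<open>- dual_radon \<psi> x\<close>.\<close>

lemma radon_eq_dp_if_halfspace_measure:
  fixes M :: "'a::euclidean_space measure"
  assumes M: "admissible_measure M"
    and ae: "AE z in halfspace_params_measure. measure M (halfspace (fst z) (snd z)) = a z"
  shows "radon_eq_dp M a"
  unfolding radon_eq_dp_def
proof (intro allI impI)
  fix \<psi> :: "'a \<times> real \<Rightarrow> real" assume psi: "halfspace_test_fun \<psi>"
  let ?Z = "halfspace_params_measure :: ('a \<times> real) measure"
  let ?L = "restrict_space lborel {..<0::real}"
  obtain D e R where D: "continuous_on UNIV D"
    and der: "\<And>\<omega> p. ((\<lambda>q. \<psi> (\<omega>, q)) has_real_derivative D (\<omega>, p)) (at p)"
    and eR: "e > 0" "R > 0"
    and supp: "\<And>\<omega> p. norm \<omega> = 1 \<Longrightarrow> p \<notin> {-R..-e} \<Longrightarrow> \<psi> (\<omega>, p) = 0 \<and> D (\<omega>, p) = 0"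
    using halfspace_test_fun_partial[OF psi] by blast
  interpret S: prob_space "sphere_measure :: 'a measure" by (rule prob_space_sphere_measure)
  interpret L: sigma_finite_measure ?L by (rule sigma_finite_negative_reals)
  interpret SL: pair_sigma_finite "sphere_measure :: 'a measure" ?L ..
  interpret M: sigma_finite_measure M by (rule sigma_finite_admissible[OF M])
  interpret Z: sigma_finite_measure ?Z unfolding halfspace_params_measure_def by (rule SL.sigma_finite_measure_axioms)
  interpret ZM: pair_sigma_finite ?Z M ..
  have sM[measurable_cong]: "sets M = sets borel" using M by (rule admissible_measure_sets)
  have spM: "space M = UNIV" using sets_eq_imp_space_eq[OF sM] by simp
  have Dm[measurable]: "D \<in> borel_measurable borel" using D by (rule borel_measurable_continuous_onI)
  have "deriv (\<lambda>q. \<psi> (fst z, q)) (snd z) = D z" for z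
    using DERIV_imp_deriv[OF der[of "fst z" "snd z"]] by simp
  then have deriv: "(\<lambda>z. a z * deriv (\<lambda>q. \<psi> (fst z, q)) (snd z)) = (\<lambda>z. a z * D z)" by simp
  define F where "F = (\<lambda>z x. indicator (halfspace (fst z) (snd z)) x * D z)"
  have "(\<lambda>y. case_prod F y) \<in> borel_measurable (borel :: (('a \<times> real) \<times> 'a) measure)"
  proof -
    have "(\<lambda>y::('a \<times> real) \<times> 'a. D (fst y)) \<in> borel_measurable borel"
      by (intro borel_measurable_continuous_onI continuous_on_compose2[OF D] continuous_intros) auto
    moreover have "{y::('a \<times> real) \<times> 'a. snd y \<bullet> fst (fst y) < snd (fst y)} \<in> sets borel"
      by (intro borel_open open_Collect_less continuous_intros)
    ultimately have "(\<lambda>y. indicator {y::('a \<times> real) \<times> 'a. snd y \<bullet> fst (fst y) < snd (fst y)} y * D (fst y)) \<in> borel_measurable borel"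
      by measurable
    also have "(\<lambda>y. indicator {y::('a \<times> real) \<times> 'a. snd y \<bullet> fst (fst y) < snd (fst y)} y * D (fst y)) = case_prod F"
      by (auto simp: F_def halfspace_def indicator_def fun_eq_iff)
    finally show ?thesis .
  qed
  moreover have "(\<lambda>y. y) \<in> measurable (?Z \<Otimes>\<^sub>M M) (borel :: (('a \<times> real) \<times> 'a) measure)"
  proof -
    have "(\<lambda>y. (fst y, snd y)) \<in> measurable (?Z \<Otimes>\<^sub>M M) ((borel :: ('a \<times> real) measure) \<Otimes>\<^sub>M (borel :: 'a measure))"
      by (intro measurable_Pair measurable_compose[OF measurable_fst measurable_halfspace_params_borel] 
          measurable_compose[OF measurable_snd]) measurable
    then show ?thesis by (simp add: borel_prod)
  qed
  ultimately have Fm: "case_prod F \<in> borel_measurable (?Z \<Otimes>\<^sub>M M)" by (rule measurable_compose[rotated])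
  have "compact (D ` (sphere 0 1 \<times> {-R..-e}))"
    by (intro compact_continuous_image continuous_on_subset[OF D] compact_Times) auto
  then obtain C where C0: "\<forall>y\<in>D ` (sphere 0 1 \<times> {-R..-e}). norm y \<le> C"
    using compact_imp_bounded bounded_iff by blast
  have C: "\<bar>D z\<bar> \<le> C" if "z \<in> sphere 0 1 \<times> {-R..-e}" for z
    using bspec[OF C0 imageI[OF that]] by simp
  let ?B = "sphere (0::'a) 1 \<times> ({-R..-e} \<inter> {..<0})" and ?T = "{x::'a. e \<le> norm x}"
  have Bm: "sphere (0::'a) 1 \<in> sets sphere_measure" "{-R..-e} \<inter> {..<0} \<in> sets ?L"
    by (auto simp: sets_sphere_measure sets_restrict_space)
  have BZ: "?B \<in> sets ?Z" unfolding halfspace_params_measure_def using Bm by (rule pair_measureI)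
  have Bfin: "emeasure ?Z ?B < \<infinity>"
  proof -
    have "emeasure ?Z ?B = emeasure sphere_measure (sphere (0::'a) 1) * emeasure ?L ({-R..-e} \<inter> {..<0})"
      unfolding halfspace_params_measure_def by (rule L.emeasure_pair_measure_Times[OF Bm])
    moreover have "emeasure ?L ({-R..-e} \<inter> {..<0}) < \<infinity>"
    proof -
      have "emeasure ?L ({-R..-e} \<inter> {..<0}) = emeasure lborel ({-R..-e} \<inter> {..<0})"
        by (rule emeasure_restrict_space) auto
      also have "\<dots> \<le> emeasure lborel {-R..-e}" by (intro emeasure_mono) auto
      also have "\<dots> < \<infinity>" by (simp add: emeasure_lborel_Icc_eq)
      finally show ?thesis .
    qed
    moreover have "emeasure sphere_measure (sphere (0::'a) 1) < \<infinity>"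
      using S.emeasure_finite[of "sphere 0 1"] by (simp only: less_top infinity_ennreal_def)
    ultimately show ?thesis by (simp add: ennreal_mult_less_top)
  qed
  have Tm: "?T \<in> sets M" by (simp add: sM)
  have Tfin: "emeasure M ?T < \<infinity>" using admissible_finite[OF M eR(1) order_refl] .
  \<comment> \<open>If \<open>D z\<close> is non-zero then the level is at most \<open>- e\<close>,
    and a point of such a half-space has norm at least \<open>e\<close>. So \<open>F\<close> lives
    on a product of two sets of finite measure.\<close>
  have bound: "\<bar>F z x\<bar> \<le> C * (indicator ?B z * indicator ?T x)" if z: "z \<in> space ?Z" for z x
  proof (cases "D z = 0 \<or> x \<notin> halfspace (fst z) (snd z)")
    case False
    have z': "norm (fst z) = 1" "snd z < 0" using z by (auto simp: space_halfspace_params)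
    have "snd z \<in> {-R..-e}" using supp[OF z'(1), of "snd z"] False by auto
    moreover have "- snd z \<le> norm x" using halfspace_subset[OF z'(1), of "snd z"] z'(2) False by auto
    ultimately have "z \<in> ?B" "x \<in> ?T" using z' by (auto simp: mem_Times_iff)
    moreover have "\<bar>D z\<bar> \<le> C" using \<open>z \<in> ?B\<close> by (intro C) auto
    ultimately show ?thesis using False by (simp add: F_def)
  next
    case True
    \<comment> \<open>The bound \<open>C\<close> comes from a compact image that may be empty, so
      its sign is known only when \<open>?B\<close> has a point.\<close>
    have "C \<ge> 0 \<or> ?B = {}"
    proof (cases "?B = {}")
      case False
      then obtain y where "y \<in> ?B" by blast
      then have "\<bar>D y\<bar> \<le> C" by (intro C) auto
      then show ?thesis using abs_ge_zero[of "D y"] by linarith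
    qed simp
    then have "0 \<le> C * (indicator ?B z * indicator ?T x)" by (auto simp: indicator_def)
    then show ?thesis using True by (auto simp: F_def)
  qed
  have Fint: "integrable (?Z \<Otimes>\<^sub>M M) (case_prod F)"
  proof (rule Bochner_Integration.integrable_bound)
    have "emeasure (?Z \<Otimes>\<^sub>M M) (?B \<times> ?T) < \<infinity>"
      using Bfin Tfin by (simp add: M.emeasure_pair_measure_Times[OF BZ Tm] ennreal_mult_less_top)
    then show "integrable (?Z \<Otimes>\<^sub>M M) (\<lambda>y. C * indicator (?B \<times> ?T) y)"
      using BZ Tm by (intro integrable_mult_right integrable_real_indicator) auto
    show "AE y in ?Z \<Otimes>\<^sub>M M. norm (case_prod F y) \<le> norm (C * indicator (?B \<times> ?T) y)"
      using bound by (intro AE_I2)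
        (auto simp: space_pair_measure indicator_times intro!: order_trans[OF _ abs_ge_self])
  qed (rule Fm)
  \<comment> \<open>Product integrability would give this only for almost every \<open>x\<close>;
    the direct bound gives it for each \<open>x\<close>, so that \<open>inner\<close> holds
    everywhere.\<close>
  have Fint1: "integrable ?Z (\<lambda>z. F z x)" for x
  proof (rule Bochner_Integration.integrable_bound)
    show "integrable ?Z (\<lambda>z. C * indicator ?B z)"
      using BZ Bfin by (intro integrable_mult_right integrable_real_indicator) auto
    show "(\<lambda>z. F z x) \<in> borel_measurable ?Z"
      using measurable_compose[OF measurable_Pair2'[of x M ?Z] Fm] spM by simp
    show "AE z in ?Z. norm (F z x) \<le> norm (C * indicator ?B z)"
    proof (rule AE_I2)
      fix z assume "z \<in> space ?Z"
      from bound[OF this, of x] show "norm (F z x) \<le> norm (C * indicator ?B z)"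
        by (cases "z \<in> ?B"; cases "e \<le> norm x") (auto intro: order_trans[OF _ abs_ge_self])
    qed
  qed
  have inner: "(\<integral>z. F z x \<partial>?Z) = - dual_radon \<psi> x" for x
  proof -
    have "(\<integral>z. F z x \<partial>?Z) = (\<integral>\<omega>. \<integral>p. F (\<omega>, p) x \<partial>?L \<partial>sphere_measure)"
      unfolding halfspace_params_measure_def
      by (rule SL.integral_fst'[symmetric]) (use Fint1 in \<open>simp add: halfspace_params_measure_def\<close>)
    also have "\<dots> = (\<integral>\<omega>. - \<psi> (\<omega>, x \<bullet> \<omega>) \<partial>sphere_measure)"
    proof (rule Bochner_Integration.integral_cong[OF refl])
      fix \<omega> :: 'a assume "\<omega> \<in> space sphere_measure"
      then have w: "norm \<omega> = 1" by (simp add: space_sphere_measure)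
      show "(\<integral>p. F (\<omega>, p) x \<partial>?L) = - \<psi> (\<omega>, x \<bullet> \<omega>)"
        using integral_partial_test_fun[OF D der eR(1) w supp, where x=x] by (simp add: F_def)
    qed
    finally show ?thesis by (simp add: dual_radon_def)
  qed
  have outer: "(\<integral>x. F z x \<partial>M) = measure M (halfspace (fst z) (snd z)) * D z" for z
  proof -
    have "(\<integral>x. F z x \<partial>M) = (\<integral>x. indicator (halfspace (fst z) (snd z)) x \<partial>M) * D z"
      unfolding F_def by (cases "D z = 0") auto
    then show ?thesis using spM by simp
  qed
  let ?m = "\<lambda>z. measure M (halfspace (fst z) (snd z)) * D z"
  have mint: "?m \<in> borel_measurable ?Z"
    using borel_measurable_integrable[OF ZM.integrable_fst[OF Fint]] by (simp add: outer)
  have aeD: "AE z in completion ?Z. ?m z = a z * D z"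
    using AE_completion[OF ae] by eventually_elim simp
  have mc: "?m \<in> borel_measurable (completion ?Z)" using mint by (rule measurable_completion)
  \<comment> \<open>On the completion, almost everywhere equality with the measurable
    \<open>?m\<close> also yields measurability of the integrand containing
    \<open>a\<close>.\<close>
  have "(\<integral>z. a z * D z \<partial>completion ?Z) = (\<integral>z. ?m z \<partial>completion ?Z)"
    by (rule integral_cong_AE[OF borel_measurable_completion_AE[OF mc aeD] mc]) (use aeD in auto)
  also have "\<dots> = (\<integral>z. ?m z \<partial>?Z)" by (rule integral_completion[OF mint])
  also have "\<dots> = (\<integral>z. \<integral>x. F z x \<partial>M \<partial>?Z)" by (simp add: outer)
  also have "\<dots> = (\<integral>x. \<integral>z. F z x \<partial>?Z \<partial>M)" by (rule ZM.Fubini_integral[OF Fint, symmetric])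
  also have "\<dots> = - (\<integral>x. dual_radon \<psi> x \<partial>M)" by (simp add: inner)
  finally show "(\<integral>x. dual_radon \<psi> x \<partial>M) = - (\<integral>z. a z * deriv (\<lambda>q. \<psi> (fst z, q)) (snd z) \<partial>completion ?Z)"
    unfolding deriv by simp
qed

theorem mainTheorem4:
  fixes a :: "'a::euclidean_space \<times> real \<Rightarrow> real" and \<beta> :: real
  assumes loc_bdd: "\<And>K. compact K \<Longrightarrow> K \<subseteq> sphere 0 1 \<times> {..<0} \<Longrightarrow> bounded (a ` K)"
    and homog: "\<And>\<omega> t p. \<omega> \<in> sphere 0 1 \<Longrightarrow> t > 0 \<Longrightarrow> p < 0 \<Longrightarrow>
                  a (\<omega>, t * p) = t powr (- \<beta>) * a (\<omega>, p)"
    and beta_pos: "\<beta> > 0"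
    and beta_nonint: "\<beta> \<notin> \<int>"
  shows "(\<forall>M1 M2. admissible_measure M1 \<and> admissible_measure M2 \<and>
            (AE z in halfspace_params_measure. measure M1 (halfspace (fst z) (snd z)) = a z) \<and>
            (AE z in halfspace_params_measure. measure M2 (halfspace (fst z) (snd z)) = a z)
            \<longrightarrow> M1 = M2)
       \<and> (\<forall>M. admissible_measure M \<and>
            (AE z in halfspace_params_measure. measure M (halfspace (fst z) (snd z)) = a z)
            \<longrightarrow> homogeneous_measure M (- real DIM('a) - \<beta>) \<and> radon_eq_dp M a)"
proof (intro conjI allI impI; elim conjE)
  \<comment> \<open>The profile obtained is \<open>a (\<omega>, -1)\<close> for every solution, so
    two solutions share it.\<close>
  note params = AE_halfspace_params[where a=a, OF _ _ homog]
  fix M1 M2 :: "'a measure"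
  assume M: "admissible_measure M1" "admissible_measure M2"
    and ae: "AE z in halfspace_params_measure. measure M1 (halfspace (fst z) (snd z)) = a z"
      "AE z in halfspace_params_measure. measure M2 (halfspace (fst z) (snd z)) = a z"
  show "M1 = M2"
    by (rule admissible_measure_unique[OF M params[OF M(1) ae(1)] params[OF M(2) ae(2)] beta_pos beta_nonint])
next
  fix M :: "'a measure"
  assume M: "admissible_measure M"
    and ae: "AE z in halfspace_params_measure. measure M (halfspace (fst z) (snd z)) = a z"
  show "homogeneous_measure M (- real DIM('a) - \<beta>)"
    by (rule homogeneous_measure_if_halfspaces_homogeneous[OF M AE_halfspace_params[OF M ae homog] beta_pos beta_nonint])
  show "radon_eq_dp M a" by (rule radon_eq_dp_if_halfspace_measure[OF M ae])
qed

end
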